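(* There is a family $\{\mathcal{K}_n\}_{n\in\mathbb{N}}$ of folded ribbon knots (of width $1$) such that: (1) if $n$ is odd, $\mathcal{K}_n$ is a topological M\"obius band with ribbon linking number $\pm n$; (2) if $n$ is even, $\mathcal{K}_n$ is a topological annulus with ribbon linking number $\pm n/2$; (3) there exists a constant $\lambda$ such that for all $n\in\mathbb{N}$ the folded ribbon length satisfies $\mathrm{Rib}(\mathcal{K}_n)<\lambda$; in fact $\lambda=8$ suffices.
   Context: Informally, a folded ribbon knot is a strip of paper of width $1$ that is folded flat into the plane along straight creases and whose two ends are joined, together with the information of which layers lie above which. Precisely, a folded ribbon knot $\mathcal{K}$ of width $1$ consists of the following data. Centerline. A closed oriented polygonal curve $C\subset\mathbb{R}^2$ with vertices $v_1,\dots,v_m$ and edges $e_i=[v_i,v_{i+1}]$ (indices mod $m$), whose only self-intersections are finitely many transverse double points interior to two edges. Let $\theta_i\in(0,\pi)$ be the angle between the two edges at $v_i$. The fold line $\ell_i$ is the closed segment centered at $v_i$, perpendicular to the bisector of the angle at $v_i$, of length $1/\cos(\theta_i/2)$. It is required that $\ell_i\cap\ell_{i+1}=\emptyset$ for all $i$. The face $P_i$ is the convex quadrilateral having $\ell_i,\ell_{i+1}$ as opposite sides and whose other two sides are parallel to $e_i$ at distance $1/2$ from it. Gluing abstractly each $P_i$ to $P_{i+1}$ along $\ell_{i+1}$ gives a flat band $M$ of width $1$, isometric to $([0,1]\times[0,L])/\sim$, where $L$ is the length of $C$ and $\sim$ is $(t,0)\sim(t,L)$ (annulus) or $(t,0)\sim(1-t,L)$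 (M\"obius band), with $\{1/2\}\times[0,L]$ corresponding to $C$. Let $\Phi:M\to\mathbb{R}^2$ be the folding map, which is the inclusion on each $P_i$. One says $\mathcal{K}$ is a topological annulus or M\"obius band according to the type of $M$. Layering. For each $p\in\mathbb{R}^2$, a strict total order ("above") on the finite set of points $x\in\Phi^{-1}(p)$ lying in interiors of faces, such that: (i) the order is locally constant: if $x$ is above $y$, then $x'$ is above $y'$ for all $x',y'$ close to $x,y$ with $\Phi(x')=\Phi(y')$; (ii) if $z$ is an interior point of the fold line joining faces $P,Q$ and $y$ lies in the interior of a third face $R$ with $\Phi(y)=\Phi(z)$, then over points near $\Phi(z)$ covered by $P$ and $Q$ near $z$, the sheet of $R$ near $y$ is not between the sheets of $P$ and $Q$; (iii) if two fold lines, joining $P,Q$ and $P',Q'$ respectively, overlap in a segment in the plane and the sheets near that segment lie on the same side, then the pairs $\{P,Q\}$ and $\{P',Q'\}$ are not interleaved in the order near that segment. (So no layer passes through another layer.) Ribbon linking number. This is the linking number between the centerline and one boundary component, oriented parallel to each other, after slightly separating the layers vertically according to the layering. Concretely, for small $\delta>0$ let $B_\delta$ be the $\Phi$-image of the following closed curve in $M$: if $M$ is an annulus, one of the two curves of points at distance $\delta$ from the center line; if $M$ is a M\"obius band, the single closed curve of all points at distance $\delta$ from the center line (it runs around twice). Orient $B_\delta$ parallel to $C$. The ribbon linking number is half the sum of the signs of the crossings in the plane between $C$ and $B_\delta$, with over/under information given by the layering. Folded ribbon length. $\mathrm{Rib}(\mathcal{K})$ is the ratio of the length of the centerline to the width;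 since all widths are $1$, it is the length $L$ of $C$. *)

theory Defs
  imports "HOL-Analysis.Analysis"
begin

section \<open>Gluing topological spaces\<close>

text \<open>The quotient of a space by the equivalence relation generated by \<open>G\<close>; its points are the
  equivalence classes.\<close>

definition glue :: "'a topology \<Rightarrow> ('a \<times> 'a) set \<Rightarrow> 'a set topology" where
  "glue X G = (let r = (G \<union> G\<inverse>)\<^sup>* in
     topology (\<lambda>U. U \<subseteq> topspace X // r \<and> openin X {x \<in> topspace X. r `` {x} \<in> U}))"

lemma openin_glue:
  "openin (glue X G) U \<longleftrightarrow> U \<subseteq> topspace X // (G \<union> G\<inverse>)\<^sup>* \<and>
     openin X {x \<in> topspace X. (G \<union> G\<inverse>)\<^sup>* `` {x} \<in> U}"
proof -
  let ?r = "(G \<union> G\<inverse>)\<^sup>*"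
  have "istopology (\<lambda>U. U \<subseteq> topspace X // ?r \<and> openin X {x \<in> topspace X. ?r `` {x} \<in> U})"
    unfolding istopology_def
  proof (intro conjI allI impI)
    fix S T
    assume S: "S \<subseteq> topspace X // ?r \<and> openin X {x \<in> topspace X. ?r `` {x} \<in> S}"
      and T: "T \<subseteq> topspace X // ?r \<and> openin X {x \<in> topspace X. ?r `` {x} \<in> T}"
    show "S \<inter> T \<subseteq> topspace X // ?r" using S by blast
    have "{x \<in> topspace X. ?r `` {x} \<in> S \<inter> T} =
        {x \<in> topspace X. ?r `` {x} \<in> S} \<inter> {x \<in> topspace X. ?r `` {x} \<in> T}" by blast
    then show "openin X {x \<in> topspace X. ?r `` {x} \<in> S \<inter> T}"
      using S T by (simp only: openin_Int)
  next
    fix \<K>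
    assume K: "\<forall>U\<in>\<K>. U \<subseteq> topspace X // ?r \<and> openin X {x \<in> topspace X. ?r `` {x} \<in> U}"
    show "\<Union>\<K> \<subseteq> topspace X // ?r" using K by blast
    have "{x \<in> topspace X. ?r `` {x} \<in> \<Union>\<K>} = (\<Union>U\<in>\<K>. {x \<in> topspace X. ?r `` {x} \<in> U})" by blast
    then show "openin X {x \<in> topspace X. ?r `` {x} \<in> \<Union>\<K>}" using K by auto
  qed
  then show ?thesis by (simp add: glue_def Let_def)
qed

definition annulus :: "real \<Rightarrow> (real \<times> real) set topology" where
  "annulus L = glue (top_of_set ({0..1} \<times> {0..L})) {((t, 0), (t, L)) | t. t \<in> {0..1}}"

definition mobius_band :: "real \<Rightarrow> (real \<times> real) set topology" where
  "mobius_band L = glue (top_of_set ({0..1} \<times> {0..L})) {((t, 0), (1 - t, L)) | t. t \<in> {0..1}}"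

section \<open>Centerline, fold lines and faces\<close>

text \<open>The plane is the type of complex numbers. Vertices, edges, fold lines and faces are numbered
  from \<open>0\<close> and the numbering is extended periodically. A point of the band lying in the interior of
  a face is a pair of a face number and a point of the plane, so \<open>above K p i j\<close> says that the
  point of face \<open>i\<close> over \<open>p\<close> is above the point of face \<open>j\<close> over \<open>p\<close>; it is meaningful for
  \<open>i, j \<in> sheets K p\<close> only.\<close>

record folded_ribbon =
  verts :: "complex list"
  above :: "complex \<Rightarrow> nat \<Rightarrow> nat \<Rightarrow> bool"

abbreviation num_verts :: "folded_ribbon \<Rightarrow> nat" where
  "num_verts K \<equiv> length (verts K)"

definition vertex :: "folded_ribbon \<Rightarrow> nat \<Rightarrow> complex" where
  "vertex K i = verts K ! (i mod num_verts K)"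

definition edge :: "folded_ribbon \<Rightarrow> nat \<Rightarrow> complex set" where
  "edge K i = closed_segment (vertex K i) (vertex K (Suc i))"

definition edge_vec :: "folded_ribbon \<Rightarrow> nat \<Rightarrow> complex" where
  "edge_vec K i = vertex K (Suc i) - vertex K i"

text \<open>The vectors from vertex \<open>i\<close> to its two neighbours are \<open>to_prev K i\<close> and \<open>edge_vec K i\<close>.\<close>

definition to_prev :: "folded_ribbon \<Rightarrow> nat \<Rightarrow> complex" where
  "to_prev K i = vertex K (i + num_verts K - 1) - vertex K i"

definition fold_angle :: "folded_ribbon \<Rightarrow> nat \<Rightarrow> real" where
  "fold_angle K i = arccos ((to_prev K i \<bullet> edge_vec K i) / (norm (to_prev K i) * norm (edge_vec K i)))"

definition bisector :: "folded_ribbon \<Rightarrow> nat \<Rightarrow> complex" where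
  "bisector K i = sgn (to_prev K i) + sgn (edge_vec K i)"

text \<open>Half of the fold line: perpendicular to the bisector, of length
  \<open>1 / (2 * cos (fold_angle K i / 2))\<close>.\<close>

definition fold_half :: "folded_ribbon \<Rightarrow> nat \<Rightarrow> complex" where
  "fold_half K i = (1 / (2 * cos (fold_angle K i / 2))) *\<^sub>R (\<i> * sgn (bisector K i))"

definition fold_line :: "folded_ribbon \<Rightarrow> nat \<Rightarrow> complex set" where
  "fold_line K i = closed_segment (vertex K i - fold_half K i) (vertex K i + fold_half K i)"

definition fold_line_interior :: "folded_ribbon \<Rightarrow> nat \<Rightarrow> complex set" where
  "fold_line_interior K i = open_segment (vertex K i - fold_half K i) (vertex K i + fold_half K i)"

text \<open>The ends of both fold lines lie on the two lines parallel to edge \<open>i\<close> at distance \<open>1/2\<close>, and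
  disjointness of the fold lines makes them opposite sides of the quadrilateral spanned by the four
  ends.\<close>

definition face :: "folded_ribbon \<Rightarrow> nat \<Rightarrow> complex set" where
  "face K i = convex hull (fold_line K i \<union> fold_line K (Suc i))"

text \<open>The parameters \<open>(i, s)\<close>, with \<open>s < 1\<close> so that each vertex is counted only once, at which the
  closed centerline passes through \<open>p\<close>.\<close>

definition passes :: "folded_ribbon \<Rightarrow> complex \<Rightarrow> (nat \<times> real) set" where
  "passes K p = {(i, s). i < num_verts K \<and> 0 \<le> s \<and> s < 1 \<and> vertex K i + s *\<^sub>R edge_vec K i = p}"

definition cross2 :: "complex \<Rightarrow> complex \<Rightarrow> real" where
  "cross2 u w = Im (cnj u * w)"

definition centerline_ok :: "folded_ribbon \<Rightarrow> bool" where
  "centerline_ok K \<longleftrightarrow>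
     3 \<le> num_verts K \<and>
     (\<forall>i < num_verts K. vertex K i \<noteq> vertex K (Suc i)) \<and>
     (\<forall>i < num_verts K. 0 < fold_angle K i \<and> fold_angle K i < pi) \<and>
     (\<forall>p. finite (passes K p) \<and> card (passes K p) \<le> 2) \<and>
     (\<forall>p i s j t. (i, s) \<in> passes K p \<and> (j, t) \<in> passes K p \<and> (i, s) \<noteq> (j, t) \<longrightarrow>
        0 < s \<and> 0 < t \<and> cross2 (edge_vec K i) (edge_vec K j) \<noteq> 0) \<and>
     finite {p. card (passes K p) = 2}"

text \<open>The band: the disjoint union of the faces, glued along the fold lines.\<close>

definition band :: "folded_ribbon \<Rightarrow> (nat \<times> complex) set topology" where
  "band K = glue (sum_topology (\<lambda>i. top_of_set (face K i)) {..<num_verts K})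
     {((i, x), (Suc i mod num_verts K, x)) | i x. i < num_verts K \<and> x \<in> fold_line K (Suc i)}"

section \<open>Layering\<close>

definition sheets :: "folded_ribbon \<Rightarrow> complex \<Rightarrow> nat set" where
  "sheets K p = {i. i < num_verts K \<and> p \<in> interior (face K i)}"

definition between :: "folded_ribbon \<Rightarrow> complex \<Rightarrow> nat \<Rightarrow> nat \<Rightarrow> nat \<Rightarrow> bool" where
  "between K p r i j \<longleftrightarrow> above K p i r \<and> above K p r j \<or> above K p j r \<and> above K p r i"

definition interleaved :: "folded_ribbon \<Rightarrow> complex \<Rightarrow> nat \<Rightarrow> nat \<Rightarrow> nat \<Rightarrow> nat \<Rightarrow> bool" where
  "interleaved K p i j i' j' \<longleftrightarrow> between K p i' i j \<noteq> between K p j' i j"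

definition strict_layer_order :: "folded_ribbon \<Rightarrow> bool" where
  "strict_layer_order K \<longleftrightarrow>
     (\<forall>p. irreflp_on (sheets K p) (above K p) \<and> transp_on (sheets K p) (above K p) \<and>
          totalp_on (sheets K p) (above K p))"

definition locally_constant_order :: "folded_ribbon \<Rightarrow> bool" where
  "locally_constant_order K \<longleftrightarrow>
     (\<forall>p. \<forall>i \<in> sheets K p. \<forall>j \<in> sheets K p. above K p i j \<longrightarrow> (\<forall>\<^sub>F q in nhds p. above K q i j))"

definition no_sheet_through_fold :: "folded_ribbon \<Rightarrow> bool" where
  "no_sheet_through_fold K \<longleftrightarrow>
     (\<forall>k < num_verts K. \<forall>r < num_verts K. r \<noteq> k \<and> r \<noteq> Suc k mod num_verts K \<longrightarrow>
        (\<forall>z \<in> fold_line_interior K (Suc k) \<inter> interior (face K r).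
           \<forall>\<^sub>F p in nhds z. {k, Suc k mod num_verts K} \<subseteq> sheets K p \<longrightarrow>
             \<not> between K p r k (Suc k mod num_verts K)))"

text \<open>If the sheets at the two fold lines lie on opposite sides, no point lies in all four of them,
  so the condition concerns only sheets on the same side.\<close>

definition no_fold_through_fold :: "folded_ribbon \<Rightarrow> bool" where
  "no_fold_through_fold K \<longleftrightarrow>
     (\<forall>k < num_verts K. \<forall>l < num_verts K. k \<noteq> l \<longrightarrow>
        (\<forall>a b. a \<noteq> b \<and> closed_segment a b \<subseteq> fold_line K (Suc k) \<inter> fold_line K (Suc l) \<longrightarrow>
          (\<forall>z \<in> open_segment a b.
             \<forall>\<^sub>F p in nhds z. {k, Suc k mod num_verts K, l, Suc l mod num_verts K} \<subseteq> sheets K p \<longrightarrow>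
               \<not> interleaved K p k (Suc k mod num_verts K) l (Suc l mod num_verts K))))"

section \<open>Folded ribbon knots of width 1\<close>

definition folded_ribbon_knot :: "folded_ribbon \<Rightarrow> bool" where
  "folded_ribbon_knot K \<longleftrightarrow>
     centerline_ok K \<and>
     (\<forall>i < num_verts K. fold_line K i \<inter> fold_line K (Suc i) = {}) \<and>
     strict_layer_order K \<and> locally_constant_order K \<and>
     no_sheet_through_fold K \<and> no_fold_through_fold K"

definition ribbonlength :: "folded_ribbon \<Rightarrow> real" where
  "ribbonlength K = (\<Sum>i < num_verts K. dist (vertex K i) (vertex K (Suc i)))"

definition topological_annulus :: "folded_ribbon \<Rightarrow> bool" where
  "topological_annulus K \<longleftrightarrow> band K homeomorphic_space annulus (ribbonlength K)"

definition topological_mobius_band :: "folded_ribbon \<Rightarrow> bool" where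
  "topological_mobius_band K \<longleftrightarrow> band K homeomorphic_space mobius_band (ribbonlength K)"

section \<open>Ribbon linking number\<close>

text \<open>The signed distance of \<open>p\<close> from the line through edge \<open>i\<close>, positive on the left.\<close>

definition offset :: "folded_ribbon \<Rightarrow> nat \<Rightarrow> complex \<Rightarrow> real" where
  "offset K i p = (p - vertex K i) \<bullet> (\<i> * sgn (edge_vec K i))"

text \<open>Crossing a fold line exchanges the two sides of the centerline:\<close>

lemma offset_fold_line:
  assumes "x \<in> fold_line K (Suc i)" "num_verts K > 0" "edge_vec K i \<noteq> 0" "edge_vec K (Suc i) \<noteq> 0"
  shows "offset K (Suc i) x = - offset K i x"
proof -
  let ?u = "sgn (edge_vec K i)" and ?w = "sgn (edge_vec K (Suc i))"
  have prev: "vertex K (Suc i + num_verts K - 1) = vertex K i" by (simp add: vertex_def)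
  have b: "bisector K (Suc i) = ?w - ?u"
    by (simp add: bisector_def to_prev_def prev[simplified] edge_vec_def flip: sgn_minus)
  have base: "offset K i x = (x - vertex K (Suc i)) \<bullet> (\<i> * ?u)"
  proof -
    have "edge_vec K i \<bullet> (\<i> * ?u) = 0"
      by (simp add: inner_complex_def sgn_div_norm scaleR_conv_of_real field_simps)
    moreover have "x - vertex K i = (x - vertex K (Suc i)) + edge_vec K i"
      by (simp add: edge_vec_def)
    ultimately show ?thesis unfolding offset_def by (simp only: inner_add_left)
  qed
  obtain c where c: "x - vertex K (Suc i) = c *\<^sub>R (\<i> * (?w - ?u))"
  proof -
    obtain t where "x = (1 - t) *\<^sub>R (vertex K (Suc i) - fold_half K (Suc i)) +
        t *\<^sub>R (vertex K (Suc i) + fold_half K (Suc i))"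
      using assms(1) by (auto simp: fold_line_def in_segment)
    then have "x - vertex K (Suc i) = (2 * t - 1) *\<^sub>R fold_half K (Suc i)"
      by (simp add: scaleR_conv_of_real algebra_simps)
    also have "\<dots> = ((2 * t - 1) / (2 * cos (fold_angle K (Suc i) / 2)) / norm (?w - ?u)) *\<^sub>R
        (\<i> * (?w - ?u))"
      unfolding fold_half_def b sgn_div_norm[of "?w - ?u"] mult_scaleR_right scaleR_scaleR
      by (simp only: divide_inverse mult_1_left mult.assoc)
    finally show ?thesis by (rule that)
  qed
  have i_inner: "(\<i> * y) \<bullet> (\<i> * z) = y \<bullet> z" for y z :: complex
    by (simp add: inner_complex_def)
  have "?u \<bullet> ?u = 1" "?w \<bullet> ?w = 1"
    using assms(3,4) by (simp_all add: dot_square_norm norm_sgn)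
  then show ?thesis
    by (simp add: base offset_def[of K "Suc i"] c i_inner inner_diff_right inner_commute algebra_simps)
qed

text \<open>The closed curve at distance \<open>\<delta>\<close> from the center line that starts in face \<open>0\<close>, on the left
  if \<open>\<sigma> = 1\<close> and on the right if \<open>\<sigma> = -1\<close>, and is followed through the faces \<open>0, 1, 2, \<dots>\<close>
  (indices mod \<open>num_verts K\<close>), changing sides at every fold line. If \<open>num_verts K\<close> is even (the
  annulus) it closes up after one round, and the two values of \<open>\<sigma>\<close> give the two curves; if
  \<open>num_verts K\<close> is odd (the Moebius band) it closes up after two rounds and contains all points at
  distance \<open>\<delta>\<close>.\<close>

definition parallel_curve :: "folded_ribbon \<Rightarrow> real \<Rightarrow> real \<Rightarrow> (nat \<times> complex) set" where
  "parallel_curve K \<sigma> \<delta> =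
     {(k mod num_verts K, p) | k p. p \<in> face K k \<and> offset K k p = (-1) ^ k * \<sigma> * \<delta>}"

text \<open>A crossing \<open>(i, j, p)\<close> is formed at \<open>p\<close> by edge \<open>i\<close> of the centerline and the part of the
  parallel curve in face \<open>j\<close>; the latter runs in the direction of edge \<open>j\<close>. For small \<open>\<delta> > 0\<close> all
  crossings are transverse and lie in the interior of both faces.\<close>

definition crossings :: "folded_ribbon \<Rightarrow> real \<Rightarrow> real \<Rightarrow> (nat \<times> nat \<times> complex) set" where
  "crossings K \<sigma> \<delta> = {(i, j, p). i < num_verts K \<and> p \<in> edge K i \<and> (j, p) \<in> parallel_curve K \<sigma> \<delta>}"

text \<open>The sign of a crossing is that of \<open>cross2\<close> of the directions of the upper and the lower
  strand.\<close>

definition crossing_sign :: "folded_ribbon \<Rightarrow> nat \<times> nat \<times> complex \<Rightarrow> real" where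
  "crossing_sign K = (\<lambda>(i, j, p).
     if above K p i j then sgn (cross2 (edge_vec K i) (edge_vec K j))
     else sgn (cross2 (edge_vec K j) (edge_vec K i)))"

text \<open>For the annulus the value is required to be the same for both parallel curves, so that it does
  not depend on a choice.\<close>

definition has_ribbon_linking_number :: "folded_ribbon \<Rightarrow> real \<Rightarrow> bool" where
  "has_ribbon_linking_number K q \<longleftrightarrow>
     (\<forall>\<sigma> \<in> {1, -1}. \<forall>\<^sub>F \<delta> in at_right 0.
        finite (crossings K \<sigma> \<delta>) \<and> (\<Sum>c \<in> crossings K \<sigma> \<delta>. crossing_sign K c) / 2 = q)"

lemma has_ribbon_linking_number_unique:
  assumes "has_ribbon_linking_number K q" "has_ribbon_linking_number K q'"
  shows "q = q'"
proof -
  have "\<forall>\<^sub>F \<delta> in at_right 0. (\<Sum>c \<in> crossings K 1 \<delta>. crossing_sign K c) / 2 = r"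
    if "has_ribbon_linking_number K r" for r
    using that by (simp add: has_ribbon_linking_number_def eventually_conj_iff)
  from this[OF assms(1)] this[OF assms(2)] have "\<forall>\<^sub>F \<delta> in at_right (0::real). q = q'"
    by eventually_elim simp
  then show ?thesis by simp
qed

end

theory Submission
  imports Defs
begin

text \<open>Zigzag folds along vertical creases at the two sides of a thin vertical stick let the ribbon
  climb along the stick at a fixed slope: the climb costs a bounded length, however many folds are
  made. Piling the layers up in order, as in an accordion, the signs of consecutive folds cancel.
  Once the ribbon has climbed past the strand that enters the stick at the bottom, the layers may be
  put alternately on top and at the bottom of the stack, that is, the ribbon is rolled up in a spiral
  around the stick; then all fold signs are equal, and since the stick is thin, \<open>n\<close> such folds cost
  almost no length. Each spiral crease lies further out than all earlier layers, so nothing passes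
  through it. The outermost layer returns to the entering strand by two further folds, or by three if
  an annulus is needed.

  The centerline is embedded, so for small \<open>\<delta>\<close> the only crossings with the parallel curve are those
  at the folds, one for each passage of the parallel curve, and the linking number is the sum of the
  fold signs, halved for an annulus.\<close>

section \<open>Homeomorphisms of glued spaces\<close>

text \<open>The entering strand forces the climb. It lies in the middle of the stack and extends to
  one side of the stick, so a crease running around the stack at its level would cut through it. The
  creases of the zigzag have length \<open>5/4\<close>, a value fixed by the direction (4/5, 3/5),
  so those centered at level \<open>5/4\<close> or higher clear the strand. Reaching that level
  costs the same length for every \<open>n\<close>; only the thinness of the stick and the number of
  folds vary.

  A single integer per face, independent of the point of the plane, gives the layering. The order
  axioms are then immediate, and two geometric facts remain: a crease misses the interior of every
  face whose integer lies strictly between those of the two faces it joins, and no two creases share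
  a segment.

  The type of the band is decided by the parity of the number of vertices. The extra vertex of the
  annulus also adds a fold sign opposite to those of the spiral, which one more spiral fold
  compensates.\<close>

lemma equiv_generated: "equiv UNIV ((G \<union> G\<inverse>)\<^sup>*)"
  by (rule equivI) (auto simp: refl_on_def sym_rtrancl sym_Un_converse trans_rtrancl)

lemma topspace_glue: "topspace (glue X G) = topspace X // (G \<union> G\<inverse>)\<^sup>*"
proof -
  have "openin (glue X G) (topspace X // (G \<union> G\<inverse>)\<^sup>*)"
  proof -
    have "{x \<in> topspace X. (G \<union> G\<inverse>)\<^sup>* `` {x} \<in> topspace X // (G \<union> G\<inverse>)\<^sup>*} = topspace X"
      by (auto intro: quotientI)
    then show ?thesis by (simp add: openin_glue)
  qed
  then show ?thesis
    using openin_glue by (metis openin_subset openin_topspace subset_antisym)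
qed

lemma quotient_map_glue: "quotient_map X (glue X G) (\<lambda>x. (G \<union> G\<inverse>)\<^sup>* `` {x})"
  by (auto simp: quotient_map_def topspace_glue openin_glue quotient_def)

text \<open>Equality of the fibres lets each map descend along the other; by surjectivity of
  \<open>p\<close> and \<open>q\<close> the two induced maps are inverse to each other.\<close>

lemma quotient_maps_same_fibres_homeomorphic:
  assumes p: "quotient_map X Y p" and q: "quotient_map X Z q"
    and fibres: "\<And>x x'. x \<in> topspace X \<Longrightarrow> x' \<in> topspace X \<Longrightarrow> p x = p x' \<longleftrightarrow> q x = q x'"
  shows "Y homeomorphic_space Z"
proof -
  obtain g where g: "continuous_map Y Z g" "g ` topspace Y = q ` topspace X"
      "\<And>x. x \<in> topspace X \<Longrightarrow> g (p x) = q x"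
    using quotient_map_lift_exists[OF p quotient_imp_continuous_map[OF q]] fibres by metis
  obtain h where h: "continuous_map Z Y h" "h ` topspace Z = p ` topspace X"
      "\<And>x. x \<in> topspace X \<Longrightarrow> h (q x) = p x"
    using quotient_map_lift_exists[OF q quotient_imp_continuous_map[OF p]] fibres by metis
  have "h (g y) = y" if "y \<in> topspace Y" for y
  proof -
    obtain x where "x \<in> topspace X" "y = p x"
      using \<open>y \<in> topspace Y\<close> quotient_imp_surjective_map[OF p] by blast
    then show ?thesis using g h by simp
  qed
  moreover have "g (h z) = z" if "z \<in> topspace Z" for z
  proof -
    obtain x where "x \<in> topspace X" "z = q x"
      using \<open>z \<in> topspace Z\<close> quotient_imp_surjective_map[OF q] by blast
    then show ?thesis using g h by simp
  qed
  ultimately show ?thesis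
    using g(1) h(1) by (auto simp: homeomorphic_space_def homeomorphic_maps_def)
qed

text \<open>By \<open>rel\<close>, \<open>f\<close> followed by the projection of \<open>Y\<close>
  has the same fibres as the projection of \<open>X\<close>. The map \<open>f\<close> may itself
  identify points; in the application it does so along all creases but one.\<close>

lemma homeomorphic_glue:
  assumes f: "quotient_map X Y f"
    and rel: "\<And>x x'. x \<in> topspace X \<Longrightarrow> x' \<in> topspace X \<Longrightarrow>
      (x, x') \<in> (G \<union> G\<inverse>)\<^sup>* \<longleftrightarrow> (f x, f x') \<in> (H \<union> H\<inverse>)\<^sup>*"
  shows "glue X G homeomorphic_space glue Y H"
proof (rule quotient_maps_same_fibres_homeomorphic)
  show "quotient_map X (glue X G) (\<lambda>x. (G \<union> G\<inverse>)\<^sup>* `` {x})"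
    by (rule quotient_map_glue)
  show "quotient_map X (glue Y H) ((\<lambda>y. (H \<union> H\<inverse>)\<^sup>* `` {y}) \<circ> f)"
    by (rule quotient_map_compose[OF f quotient_map_glue])
qed (simp add: rel eq_equiv_class_iff[OF equiv_generated])

text \<open>A chain of \<open>H\<close>-steps is lifted to \<open>S\<close> step by step, and
  \<open>inj\<close> joins different lifts of an intermediate point.\<close>

lemma glue_relation_pullback:
  assumes sub: "\<And>x x'. (x, x') \<in> G \<Longrightarrow> (f x, f x') \<in> (H \<union> H\<inverse>)\<^sup>*"
    and inj: "\<And>x x'. x \<in> S \<Longrightarrow> x' \<in> S \<Longrightarrow> f x = f x' \<Longrightarrow> (x, x') \<in> (G \<union> G\<inverse>)\<^sup>*"
    and lift: "\<And>y y'. (y, y') \<in> H \<Longrightarrow>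
      \<exists>x x'. x \<in> S \<and> x' \<in> S \<and> f x = y \<and> f x' = y' \<and> (x, x') \<in> (G \<union> G\<inverse>)\<^sup>*"
    and x: "x \<in> S" "x' \<in> S"
  shows "(x, x') \<in> (G \<union> G\<inverse>)\<^sup>* \<longleftrightarrow> (f x, f x') \<in> (H \<union> H\<inverse>)\<^sup>*"
proof
  have sG: "(b, a) \<in> (G \<union> G\<inverse>)\<^sup>*" if "(a, b) \<in> (G \<union> G\<inverse>)\<^sup>*" for a b
    using equiv_generated[of G] that by (meson equivE symE)
  have sH: "(b, a) \<in> (H \<union> H\<inverse>)\<^sup>*" if "(a, b) \<in> (H \<union> H\<inverse>)\<^sup>*" for a b
    using equiv_generated[of H] that by (meson equivE symE)
  show "(f x, f x') \<in> (H \<union> H\<inverse>)\<^sup>*" if "(x, x') \<in> (G \<union> G\<inverse>)\<^sup>*"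
    using that
  proof (induction rule: rtrancl_induct)
    case (step y z)
    then have "(f y, f z) \<in> (H \<union> H\<inverse>)\<^sup>*" using sub sH by blast
    with step.IH show ?case by (rule rtrancl_trans)
  qed simp
  \<comment> \<open>The claim ranges over all preimages of \<open>y\<close> in \<open>S\<close>: the
    lift by which \<open>y\<close> is reached need not be the one from which the next step
    departs.\<close>
  have "\<forall>x'\<in>S. f x' = y \<longrightarrow> (x, x') \<in> (G \<union> G\<inverse>)\<^sup>*" if "(f x, y) \<in> (H \<union> H\<inverse>)\<^sup>*" for y
    using that
  proof (induction rule: rtrancl_induct)
    case base
    show ?case using inj x(1) by auto
  next
    case (step y z)
    obtain a b where ab: "a \<in> S" "b \<in> S" "f a = y" "f b = z" "(a, b) \<in> (G \<union> G\<inverse>)\<^sup>*"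
    proof (cases "(y, z) \<in> H")
      case True
      then show ?thesis using lift that by blast
    next
      case False
      then have "(z, y) \<in> H" using step.hyps by simp
      then show ?thesis using lift that sG by blast
    qed
    show ?case
    proof (intro ballI impI)
      fix x' assume "x' \<in> S" "f x' = z"
      then have "(b, x') \<in> (G \<union> G\<inverse>)\<^sup>*" using inj ab by auto
      moreover have "(x, a) \<in> (G \<union> G\<inverse>)\<^sup>*" using step.IH ab by auto
      ultimately show "(x, x') \<in> (G \<union> G\<inverse>)\<^sup>*" using ab(5) by (meson rtrancl_trans)
    qed
  qed
  then show "(x, x') \<in> (G \<union> G\<inverse>)\<^sup>*" if "(f x, f x') \<in> (H \<union> H\<inverse>)\<^sup>*" using that x by blast
qed

section \<open>Topological sums\<close>

lemma compact_space_sum_topology: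
  assumes "finite I" "\<And>i. i \<in> I \<Longrightarrow> compact_space (X i)"
  shows "compact_space (sum_topology X I)"
proof -
  have "compactin (sum_topology X I) (\<Union>i\<in>I. Pair i ` topspace (X i))"
    using assms
    by (intro compactin_Union)
       (auto intro!: image_compactin[OF _ continuous_map_component_injection] simp: compact_space_def)
  moreover have "(\<Union>i\<in>I. Pair i ` topspace (X i)) = topspace (sum_topology X I)"
    by auto
  ultimately show ?thesis by (simp add: compact_space_def)
qed

lemma continuous_map_sum_topology:
  assumes "\<And>i. i \<in> I \<Longrightarrow> continuous_map (X i) Y (\<lambda>x. f (i, x))"
  shows "continuous_map (sum_topology X I) Y f"
  unfolding continuous_map_def
proof (intro conjI allI impI)
  show "f \<in> topspace (sum_topology X I) \<rightarrow> topspace Y"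
    using assms by (force simp: continuous_map_def)
  fix U assume U: "openin Y U"
  show "openin (sum_topology X I) {x \<in> topspace (sum_topology X I). f x \<in> U}"
    unfolding openin_sum_topology
  proof (intro conjI ballI)
    fix i assume i: "i \<in> I"
    have "{x. (i, x) \<in> {x \<in> topspace (sum_topology X I). f x \<in> U}} = {x \<in> topspace (X i). f (i, x) \<in> U}"
      using i by auto
    then show "openin (X i) {x. (i, x) \<in> {x \<in> topspace (sum_topology X I). f x \<in> U}}"
      using assms[OF i] U by (simp add: continuous_map_def)
  qed auto
qed

section \<open>Local coordinates on the faces\<close>

lemma cross2_eq: "cross2 u w = Re u * Im w - Im u * Re w"
  by (simp add: cross2_def)

lemma cross2_scaleR:
  "cross2 (a *\<^sub>R u) w = a * cross2 u w" "cross2 u (a *\<^sub>R w) = a * cross2 u w"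
  by (simp_all add: cross2_eq algebra_simps)

lemma cross2_commute: "cross2 w u = - cross2 u w"
  by (simp add: cross2_eq)

text \<open>Multiplication by a unit number is a rotation, and the two products are the coordinates
  of \<open>w\<close> in the frame \<open>u\<close>, \<open>\<i> * u\<close>.\<close>

lemma unit_times:
  assumes "norm u = 1"
  shows "w = u * Complex (u \<bullet> w) (cross2 u w)"
proof -
  have "u * cnj u = 1" using assms complex_norm_square[of u] by simp
  moreover have "cnj u * w = Complex (u \<bullet> w) (cross2 u w)"
    by (simp add: complex_eq_iff inner_complex_def cross2_def)
  ultimately show ?thesis by (metis mult.assoc mult_1)
qed

lemma inner_cross2_squares:
  assumes "norm u = 1" "norm w = 1"
  shows "(u \<bullet> w)\<^sup>2 + (cross2 u w)\<^sup>2 = 1"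
proof -
  have "norm (Complex (u \<bullet> w) (cross2 u w)) = 1"
    using arg_cong[OF unit_times[OF assms(1), of w], of norm] assms by (simp add: norm_mult)
  then show ?thesis by (simp add: complex_norm)
qed

definition dir :: "folded_ribbon \<Rightarrow> nat \<Rightarrow> complex" where
  "dir K i = sgn (edge_vec K i)"

definition len :: "folded_ribbon \<Rightarrow> nat \<Rightarrow> real" where
  "len K i = norm (edge_vec K i)"

text \<open>The cotangent of half the signed turning angle at vertex \<open>i\<close>; \<open>slant K i * o\<close> measures how far
  fold line \<open>i\<close> deviates, at offset \<open>o\<close>, from the perpendicular to the centerline.\<close>

definition slant :: "folded_ribbon \<Rightarrow> nat \<Rightarrow> real" where
  "slant K i = cross2 (dir K (i + num_verts K - 1)) (dir K i) /
     (1 - dir K (i + num_verts K - 1) \<bullet> dir K i)"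

definition along :: "folded_ribbon \<Rightarrow> nat \<Rightarrow> complex \<Rightarrow> real" where
  "along K i p = (p - vertex K i) \<bullet> dir K i"

text \<open>Inverse of the chart (\<open>offset\<close>, \<open>along\<close>) in the frame of edge
  \<open>i\<close>.\<close>

definition pt :: "folded_ribbon \<Rightarrow> nat \<Rightarrow> real \<Rightarrow> real \<Rightarrow> complex" where
  "pt K i x s = vertex K i + s *\<^sub>R dir K i + x *\<^sub>R (\<i> * dir K i)"

section \<open>Periodic numbering of vertices and faces\<close>

context
  fixes K :: folded_ribbon
  assumes nonempty: "num_verts K > 0"
begin

lemma vertex_mod [simp]: "vertex K (i mod num_verts K) = vertex K i"
  by (simp add: vertex_def)

lemma vertex_Suc_mod [simp]: "vertex K (Suc (i mod num_verts K)) = vertex K (Suc i)"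
  by (simp add: vertex_def mod_Suc_eq)

lemma edge_vec_mod [simp]: "edge_vec K (i mod num_verts K) = edge_vec K i"
  by (simp add: edge_vec_def)

lemma dir_mod [simp]: "dir K (i mod num_verts K) = dir K i"
  by (simp add: dir_def)

lemma len_mod [simp]: "len K (i mod num_verts K) = len K i"
  by (simp add: len_def)

lemma offset_mod [simp]: "offset K (i mod num_verts K) = offset K i"
  by (simp add: offset_def fun_eq_iff)

lemma edge_mod [simp]: "edge K (i mod num_verts K) = edge K i"
  by (simp add: edge_def)

lemma dir_add [simp]: "dir K (i + num_verts K) = dir K i"
  by (metis dir_mod mod_add_self2)

lemma dir_pred_mod: "dir K (i mod num_verts K + num_verts K - 1) = dir K (i + num_verts K - 1)"
proof -
  have "(i mod num_verts K + (num_verts K - 1)) mod num_verts K = (i + (num_verts K - 1)) mod num_verts K"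
    by (simp add: mod_add_left_eq)
  then show ?thesis using nonempty by (metis dir_mod Nat.add_diff_assoc Suc_leI One_nat_def)
qed

lemma slant_mod [simp]: "slant K (i mod num_verts K) = slant K i"
  unfolding slant_def by (simp only: dir_pred_mod dir_mod)

lemma slant_Suc_mod [simp]: "slant K (Suc (i mod num_verts K)) = slant K (Suc i)"
  by (metis slant_mod mod_Suc_eq)

lemma dir_Suc_mod [simp]: "dir K (Suc (i mod num_verts K)) = dir K (Suc i)"
  by (metis dir_mod mod_Suc_eq)

lemma slant_Suc: "slant K (Suc i) = cross2 (dir K i) (dir K (Suc i)) / (1 - dir K i \<bullet> dir K (Suc i))"
  by (simp add: slant_def)

lemma to_prev_eq: "to_prev K i = - edge_vec K (i + num_verts K - 1)"
proof -
  have "vertex K (Suc (i + num_verts K - 1)) = vertex K i"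
    using nonempty by (simp add: vertex_def)
  then show ?thesis by (simp add: to_prev_def edge_vec_def)
qed

text \<open>Removes \<open>arccos\<close>: the bisector is \<open>w - u\<close>, and by the
  half-angle formula its norm is \<open>2 * cos (fold_angle K i / 2)\<close>.\<close>

lemma fold_half_eq_dir:
  assumes "edge_vec K (i + num_verts K - 1) \<noteq> 0" "edge_vec K i \<noteq> 0"
  defines "u \<equiv> dir K (i + num_verts K - 1)" and "w \<equiv> dir K i"
  shows "fold_half K i = (1 / (norm (w - u))\<^sup>2) *\<^sub>R (\<i> * (w - u))"
proof -
  have unit: "norm u = 1" "norm w = 1"
    using assms by (simp_all add: dir_def norm_sgn)
  have angle: "fold_angle K i = arccos (- (u \<bullet> w))"
    unfolding fold_angle_def to_prev_eq u_def w_def dir_def sgn_div_norm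
    by (simp add: divide_inverse mult.commute mult.left_commute)
  have bound: "\<bar>u \<bullet> w\<bar> \<le> 1"
    using Cauchy_Schwarz_ineq2[of u w] unit by simp
  have cos: "cos (fold_angle K i) = - (u \<bullet> w)"
    unfolding angle using bound by (intro cos_arccos) auto
  have range: "0 \<le> fold_angle K i" "fold_angle K i \<le> pi"
    unfolding angle using bound by (auto intro!: arccos_lbound arccos_ubound)
  have "cos (2 * (fold_angle K i / 2)) = - (u \<bullet> w)" using cos by simp
  then have "(2 * cos (fold_angle K i / 2))\<^sup>2 = 2 - 2 * (u \<bullet> w)"
    unfolding cos_double_cos by (simp add: power_mult_distrib)
  also have "\<dots> = (norm (w - u))\<^sup>2"
    using unit by (simp add: power2_norm_eq_inner inner_diff_left inner_diff_right inner_commute norm_eq_1)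
  finally have sq: "(2 * cos (fold_angle K i / 2))\<^sup>2 = (norm (w - u))\<^sup>2" .
  have "0 \<le> 2 * cos (fold_angle K i / 2)"
    using range by (auto intro!: cos_ge_zero)
  then have half: "2 * cos (fold_angle K i / 2) = norm (w - u)"
    using sq by (metis norm_ge_zero power2_eq_imp_eq)
  have "bisector K i = w - u"
    unfolding bisector_def to_prev_eq u_def w_def dir_def by (simp add: sgn_minus)
  then show ?thesis
    unfolding fold_half_def half by (simp add: sgn_div_norm power2_eq_square divide_inverse)
qed

lemma fold_half_mod [simp]: "fold_half K (i mod num_verts K) = fold_half K i"
proof -
  have "vertex K (i mod num_verts K + num_verts K - 1) = vertex K (i + num_verts K - 1)"
  proof -
    have "(i mod num_verts K + (num_verts K - 1)) mod num_verts K = (i + (num_verts K - 1)) mod num_verts K"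
      by (simp add: mod_add_left_eq)
    then show ?thesis using nonempty by (metis vertex_mod Nat.add_diff_assoc Suc_leI One_nat_def)
  qed
  then show ?thesis by (simp add: fold_half_def fold_angle_def bisector_def to_prev_def)
qed

lemma fold_line_mod [simp]: "fold_line K (i mod num_verts K) = fold_line K i"
  by (simp add: fold_line_def)

lemma fold_line_Suc_mod [simp]: "fold_line K (Suc (i mod num_verts K)) = fold_line K (Suc i)"
  by (metis fold_line_mod mod_Suc_eq)

lemma face_mod [simp]: "face K (i mod num_verts K) = face K i"
  by (simp add: face_def)

end

text \<open>The last condition makes consecutive fold lines disjoint.\<close>

locale ribbon =
  fixes K :: folded_ribbon
  assumes three: "3 \<le> num_verts K"
    and edge_nonzero: "edge_vec K i \<noteq> 0"
    and turning: "cross2 (dir K i) (dir K (Suc i)) \<noteq> 0"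
    and long_edges: "\<bar>slant K i + slant K (Suc i)\<bar> < 2 * len K i"
begin

lemma verts_pos: "num_verts K > 0"
  using three by linarith

lemmas mods [simp] = vertex_mod[OF verts_pos] vertex_Suc_mod[OF verts_pos] edge_vec_mod[OF verts_pos]
  dir_mod[OF verts_pos] len_mod[OF verts_pos] offset_mod[OF verts_pos] edge_mod[OF verts_pos]
  slant_mod[OF verts_pos] slant_Suc_mod[OF verts_pos] dir_Suc_mod[OF verts_pos]
  fold_line_mod[OF verts_pos] fold_line_Suc_mod[OF verts_pos] face_mod[OF verts_pos]

lemma norm_dir [simp]: "norm (dir K i) = 1"
  using edge_nonzero by (simp add: dir_def norm_sgn)

lemma len_pos: "len K i > 0"
  using edge_nonzero by (simp add: len_def)

lemma edge_vec_eq: "edge_vec K i = len K i *\<^sub>R dir K i"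
  using edge_nonzero by (simp add: len_def dir_def sgn_div_norm)

lemma vertex_Suc: "vertex K (Suc i) = vertex K i + len K i *\<^sub>R dir K i"
  by (simp add: edge_vec_def flip: edge_vec_eq)

lemma inner_dir_self [simp]: "dir K i \<bullet> dir K i = 1"
  by (metis norm_dir norm_eq_1)

lemma inner_dir_less: "\<bar>dir K i \<bullet> dir K (Suc i)\<bar> < 1"
proof -
  have "(dir K i \<bullet> dir K (Suc i))\<^sup>2 < 1"
    using inner_cross2_squares[of "dir K i" "dir K (Suc i)"] turning[of i]
    by (smt (verit) norm_dir zero_less_power2)
  then show ?thesis by (simp add: abs_square_less_1)
qed

text \<open>The same crease point in the frames of the faces before and after the fold. The offset
  changes sign, and in either frame the deviation from the perpendicular is proportional to the
  offset.\<close>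

lemma fold_point:
  "vertex K (Suc i) + (2 * x) *\<^sub>R fold_half K (Suc i) =
     pt K i (- x) (len K i - slant K (Suc i) * x)" (is ?A)
  "vertex K (Suc i) + (2 * x) *\<^sub>R fold_half K (Suc i) =
     pt K (Suc i) x (- slant K (Suc i) * x)" (is ?B)
proof -
  define u w D X where "u = dir K i" and "w = dir K (Suc i)" and "D = u \<bullet> w" and "X = cross2 u w"
  have D: "1 - D > 0" using inner_dir_less[of i] by (auto simp: D_def u_def w_def)
  have "u \<bullet> u = 1" "w \<bullet> w = 1" "u \<bullet> w = D" by (simp_all add: u_def w_def D_def)
  moreover from this have "w \<bullet> u = D" by (metis inner_commute)
  ultimately have nrm: "(norm (w - u))\<^sup>2 = 2 * (1 - D)"
    by (simp add: power2_norm_eq_inner inner_diff_left inner_diff_right)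
  have half: "fold_half K (Suc i) = (1 / (2 * (1 - D))) *\<^sub>R (\<i> * (w - u))"
    using fold_half_eq_dir[OF verts_pos edge_nonzero edge_nonzero, of "Suc i"] nrm
    by (simp add: u_def w_def dir_add[OF verts_pos])
  have w: "w = u * Complex D X" unfolding D_def X_def by (rule unit_times) (simp add: u_def)
  have u: "u = w * Complex D (- X)"
    using unit_times[of w u] inner_commute[of w u] cross2_commute[of w u]
    by (simp add: D_def X_def) (simp add: w_def)
  \<comment> \<open>\<open>D\<close> and \<open>X\<close> are the cosine and the sine of the turning
    angle; the direction of the crease is expanded in the frame of \<open>u\<close> and in that of
    \<open>w\<close>.\<close>
  have 1: "\<i> * (w - u) = (- X) *\<^sub>R u + (D - 1) *\<^sub>R (\<i> * u)"
    unfolding w by (simp add: complex_eq_iff algebra_simps)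
  have 2: "\<i> * (w - u) = (- X) *\<^sub>R w + (1 - D) *\<^sub>R (\<i> * w)"
    unfolding arg_cong[OF u, of "\<lambda>z. \<i> * (w - z)"] by (simp add: complex_eq_iff algebra_simps)
  have t: "slant K (Suc i) = X / (1 - D)"
    by (simp add: slant_Suc[OF verts_pos] X_def D_def u_def w_def)
  have c: "2 * x * (1 / (2 * (1 - D))) = x / (1 - D)" using D by (simp add: field_simps)
  have 3: "(2 * x) *\<^sub>R fold_half K (Suc i) = (x / (1 - D)) *\<^sub>R (\<i> * (w - u))"
    by (simp only: half scaleR_scaleR c)
  have 4: "x / (1 - D) * (1 - D) = x" "x / (1 - D) * (D - 1) = - x" using D by (simp_all add: field_simps)
  have "(2 * x) *\<^sub>R fold_half K (Suc i) = (- (slant K (Suc i) * x)) *\<^sub>R u + (- x) *\<^sub>R (\<i> * u)"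
    unfolding 3 1 scaleR_add_right scaleR_scaleR 4 t by simp
  then show ?A
    by (simp add: pt_def vertex_Suc u_def algebra_simps)
  have "(2 * x) *\<^sub>R fold_half K (Suc i) = (- (slant K (Suc i) * x)) *\<^sub>R w + x *\<^sub>R (\<i> * w)"
    unfolding 3 2 scaleR_add_right scaleR_scaleR 4 t by simp
  then show ?B
    by (simp add: pt_def w_def algebra_simps)
qed

section \<open>The chart of a face, its creases and its borders\<close>

lemma offset_pt [simp]: "offset K i (pt K i x s) = x"
proof -
  have 1: "dir K i \<bullet> (\<i> * dir K i) = 0" "(\<i> * dir K i) \<bullet> (\<i> * dir K i) = 1"
    using inner_dir_self[of i] by (simp_all add: inner_complex_def)
  show ?thesis
    unfolding offset_def pt_def dir_def[symmetric] by (simp add: inner_add_left 1)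
qed

lemma along_pt [simp]: "along K i (pt K i x s) = s"
proof -
  have 1: "(\<i> * dir K i) \<bullet> dir K i = 0" by (simp add: inner_complex_def)
  show ?thesis
    unfolding along_def pt_def by (simp add: inner_add_left 1)
qed

lemma pt_offset_along [simp]: "pt K i (offset K i p) (along K i p) = p"
proof -
  let ?u = "dir K i" and ?z = "p - vertex K i"
  have "?z = ?u * Complex (?u \<bullet> ?z) (cross2 ?u ?z)" by (rule unit_times) simp
  moreover have "cross2 ?u ?z = offset K i p" "?u \<bullet> ?z = along K i p"
    by (simp_all add: offset_def along_def inner_complex_def cross2_eq dir_def mult.commute)
  ultimately have "p = vertex K i + ?u * Complex (along K i p) (offset K i p)"
    by (metis diff_add_cancel add.commute)
  also have "\<dots> = pt K i (offset K i p) (along K i p)"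
    by (simp add: pt_def complex_eq_iff algebra_simps)
  finally show ?thesis by simp
qed

lemma pt_inj [simp]: "pt K i x s = pt K i y t \<longleftrightarrow> x = y \<and> s = t"
  by (metis along_pt offset_pt)

text \<open>The factor \<open>2\<close> makes the parameter an offset: by \<open>fold_point\<close>,
  the ends of a crease have offsets 1/2 and -1/2.\<close>

lemma fold_line_param: "fold_line K i = {vertex K i + (2 * x) *\<^sub>R fold_half K i | x. \<bar>x\<bar> \<le> 1/2}"
  (is "_ = ?S")
proof
  show "fold_line K i \<subseteq> ?S"
  proof
    fix p assume "p \<in> fold_line K i"
    then obtain t where t: "0 \<le> t" "t \<le> 1"
      "p = (1 - t) *\<^sub>R (vertex K i - fold_half K i) + t *\<^sub>R (vertex K i + fold_half K i)"
      by (auto simp: fold_line_def in_segment)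
    have "p = vertex K i + (2 * (t - 1/2)) *\<^sub>R fold_half K i"
      unfolding t(3) by (simp add: scaleR_conv_of_real algebra_simps)
    moreover have "\<bar>t - 1/2\<bar> \<le> 1/2" using t by linarith
    ultimately show "p \<in> ?S" by blast
  qed
  show "?S \<subseteq> fold_line K i"
  proof clarify
    fix x :: real assume "\<bar>x\<bar> \<le> 1/2"
    then have "0 \<le> x + 1/2" "x + 1/2 \<le> 1" by linarith+
    moreover have "vertex K i + (2 * x) *\<^sub>R fold_half K i =
       (1 - (x + 1/2)) *\<^sub>R (vertex K i - fold_half K i) + (x + 1/2) *\<^sub>R (vertex K i + fold_half K i)"
      by (simp add: scaleR_conv_of_real algebra_simps)
    ultimately show "vertex K i + (2 * x) *\<^sub>R fold_half K i \<in> fold_line K i"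
      unfolding fold_line_def in_segment by blast
  qed
qed

lemma fold_line_end:
  "fold_line K (Suc i) = {pt K i x (len K i + slant K (Suc i) * x) | x. \<bar>x\<bar> \<le> 1/2}"
  (is "_ = ?S")
proof
  show "fold_line K (Suc i) \<subseteq> ?S"
    unfolding fold_line_param fold_point(1)
  proof clarify
    fix x :: real assume "\<bar>x\<bar> \<le> 1/2"
    then show "\<exists>y. pt K i (- x) (len K i - slant K (Suc i) * x) =
        pt K i y (len K i + slant K (Suc i) * y) \<and> \<bar>y\<bar> \<le> 1/2"
      by (intro exI[of _ "- x"]) simp
  qed
  show "?S \<subseteq> fold_line K (Suc i)"
    unfolding fold_line_param fold_point(1)
  proof clarify
    fix x :: real assume "\<bar>x\<bar> \<le> 1/2"
    then show "\<exists>y. pt K i x (len K i + slant K (Suc i) * x) =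
        pt K i (- y) (len K i - slant K (Suc i) * y) \<and> \<bar>y\<bar> \<le> 1/2"
      by (intro exI[of _ "- x"]) simp
  qed
qed

lemma periodic:
  "vertex K (i + num_verts K) = vertex K i" "dir K (i + num_verts K) = dir K i"
  "slant K (i + num_verts K) = slant K i" "fold_line K (i + num_verts K) = fold_line K i"
  "pt K (i + num_verts K) = pt K i"
proof -
  show v: "vertex K (i + num_verts K) = vertex K i" and d: "dir K (i + num_verts K) = dir K i"
    by (metis mods(1) mod_add_self2, metis mods(4) mod_add_self2)
  show "slant K (i + num_verts K) = slant K i" "fold_line K (i + num_verts K) = fold_line K i"
    by (metis mods(8) mod_add_self2, metis mods(11) mod_add_self2)
  show "pt K (i + num_verts K) = pt K i" by (simp add: pt_def v d fun_eq_iff)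
qed

lemma fold_line_start: "fold_line K i = {pt K i x (- slant K i * x) | x. \<bar>x\<bar> \<le> 1/2}"
proof -
  \<comment> \<open>\<open>fold_point\<close> speaks of successors only, so one period is added to
    reach crease \<open>0\<close> as well.\<close>
  obtain j where j: "i + num_verts K = Suc j" using verts_pos by (metis Suc_pred add_gr_0)
  have "fold_line K (Suc j) = {pt K (Suc j) x (- slant K (Suc j) * x) | x. \<bar>x\<bar> \<le> 1/2}"
    unfolding fold_line_param fold_point(2) ..
  then show ?thesis by (simp only: j[symmetric] periodic)
qed

text \<open>The length of a face at offset \<open>x\<close> is affine in \<open>x\<close>, and
  \<open>long_edges\<close> is its positivity at both borders.\<close>

lemma width_pos:
  assumes "\<bar>x\<bar> \<le> 1/2"
  shows "0 < len K i + (slant K i + slant K (Suc i)) * x"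
proof -
  define y where "y = (slant K i + slant K (Suc i)) * x"
  have "\<bar>y\<bar> \<le> \<bar>slant K i + slant K (Suc i)\<bar> * (1/2)"
    unfolding y_def abs_mult using assms by (intro mult_left_mono) auto
  then have "\<bar>y\<bar> < len K i" using long_edges[of i] by simp
  then show ?thesis unfolding y_def[symmetric] by linarith
qed

text \<open>The right side is an intersection of half-planes that contain both creases. Conversely,
  each of its points lies on the segment parallel to the edge that joins the points of equal offset
  on the two creases.\<close>

lemma face_eq:
  "face K i = {p. \<bar>offset K i p\<bar> \<le> 1/2 \<and> - slant K i * offset K i p \<le> along K i p \<and>
     along K i p \<le> len K i + slant K (Suc i) * offset K i p}" (is "_ = ?F")
proof
  have lin: "offset K i (a *\<^sub>R p + b *\<^sub>R q) = a * offset K i p + b * offset K i q"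
    "along K i (a *\<^sub>R p + b *\<^sub>R q) = a * along K i p + b * along K i q" if "a + b = 1" for a b p q
  proof -
    have "a *\<^sub>R p + b *\<^sub>R q - vertex K i = a *\<^sub>R (p - vertex K i) + b *\<^sub>R (q - vertex K i)"
      using that by (simp add: algebra_simps flip: scaleR_add_left)
    then show "offset K i (a *\<^sub>R p + b *\<^sub>R q) = a * offset K i p + b * offset K i q"
      "along K i (a *\<^sub>R p + b *\<^sub>R q) = a * along K i p + b * along K i q"
      unfolding offset_def along_def by (simp_all only: inner_add_left inner_scaleR_left)
  qed
  have half: "convex {p. c * offset K i p + d * along K i p \<le> e}" for c d e
    unfolding convex_def
  proof (clarsimp simp: lin)
    fix p q a b
    assume h: "c * offset K i p + d * along K i p \<le> e" "c * offset K i q + d * along K i q \<le> e"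
      "0 \<le> a" "0 \<le> b" "a + b = (1::real)"
    have "a * (c * offset K i p + d * along K i p) + b * (c * offset K i q + d * along K i q) \<le> a * e + b * e"
      using h by (intro add_mono mult_left_mono) auto
    also have "\<dots> = e" using h(5) by (simp flip: distrib_right)
    finally show "c * (a * offset K i p + b * offset K i q) + d * (a * along K i p + b * along K i q) \<le> e"
      by (simp add: algebra_simps)
  qed
  have F: "?F = {p. 1 * offset K i p + 0 * along K i p \<le> 1/2} \<inter>
      {p. (-1) * offset K i p + 0 * along K i p \<le> 1/2} \<inter>
      {p. (- slant K i) * offset K i p + (-1) * along K i p \<le> 0} \<inter>
      {p. (- slant K (Suc i)) * offset K i p + 1 * along K i p \<le> len K i}"
    by (auto simp: abs_le_iff)
  have "convex ?F" unfolding F by (intro convex_Int half)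
  moreover have "fold_line K i \<subseteq> ?F"
    unfolding fold_line_start using width_pos[of _ i] by (force simp: algebra_simps intro: less_imp_le)
  moreover have "fold_line K (Suc i) \<subseteq> ?F"
    unfolding fold_line_end using width_pos[of _ i] by (force simp: algebra_simps intro: less_imp_le)
  ultimately show "face K i \<subseteq> ?F" unfolding face_def by (intro hull_minimal) auto
  show "?F \<subseteq> face K i"
  proof clarify
    fix p
    define x s where "x = offset K i p" and "s = along K i p"
    assume "\<bar>offset K i p\<bar> \<le> 1/2" "- slant K i * offset K i p \<le> along K i p"
      "along K i p \<le> len K i + slant K (Suc i) * offset K i p"
    then have h: "\<bar>x\<bar> \<le> 1/2" "- slant K i * x \<le> s" "s \<le> len K i + slant K (Suc i) * x"
      by (simp_all add: x_def s_def)
    define w where "w = len K i + (slant K i + slant K (Suc i)) * x"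
    define a where "a = pt K i x (- slant K i * x)"
    define b where "b = pt K i x (len K i + slant K (Suc i) * x)"
    have w: "w > 0" unfolding w_def using h(1) by (rule width_pos)
    define c where "c = (s + slant K i * x) / w"
    have c: "0 \<le> c" "c \<le> 1" using h w by (auto simp: c_def w_def divide_simps algebra_simps)
    have "a \<in> convex hull (fold_line K i \<union> fold_line K (Suc i))"
      using h(1) by (intro hull_inc) (auto simp: a_def fold_line_start)
    moreover have "b \<in> convex hull (fold_line K i \<union> fold_line K (Suc i))"
      using h(1) by (intro hull_inc) (auto simp: b_def fold_line_end)
    ultimately have m: "(1 - c) *\<^sub>R a + c *\<^sub>R b \<in> face K i"
      unfolding face_def using c by (intro convexD[OF convex_convex_hull]) auto
    have "c * w = s + slant K i * x" using w by (simp add: c_def)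
    then have s: "(1 - c) * (- slant K i * x) + c * (len K i + slant K (Suc i) * x) = s"
      by (simp add: w_def algebra_simps)
    have c1: "1 - c + c = 1" by simp
    have "offset K i ((1 - c) *\<^sub>R a + c *\<^sub>R b) = x"
      unfolding lin(1)[OF c1] unfolding a_def b_def offset_pt by (simp add: algebra_simps)
    moreover have "along K i ((1 - c) *\<^sub>R a + c *\<^sub>R b) = s"
      unfolding lin(2)[OF c1] unfolding a_def b_def along_pt by (rule s)
    ultimately have "(1 - c) *\<^sub>R a + c *\<^sub>R b = p"
      by (metis pt_offset_along x_def s_def)
    with m show "p \<in> face K i" by simp
  qed
qed

lemma pt_in_face:
  "pt K i x s \<in> face K i \<longleftrightarrow> \<bar>x\<bar> \<le> 1/2 \<and> - slant K i * x \<le> s \<and> s \<le> len K i + slant K (Suc i) * x"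
  by (simp add: face_eq)

lemma fold_lines_disjoint: "fold_line K i \<inter> fold_line K (Suc i) = {}"
proof -
  have False if "\<bar>x\<bar> \<le> 1/2" "- (slant K i * x) = len K i + slant K (Suc i) * x" for x
    using width_pos[OF that(1), of i] that(2) by (simp add: algebra_simps)
  then show ?thesis by (auto simp: fold_line_start[of i] fold_line_end)
qed

lemma fold_angle_bounds: "0 < fold_angle K i" "fold_angle K i < pi"
proof -
  let ?u = "dir K (i + num_verts K - 1)" and ?w = "dir K i"
  have w: "dir K (Suc (i + num_verts K - 1)) = ?w"
    using verts_pos dir_add[OF verts_pos, of i] by simp
  have u: "\<bar>?u \<bullet> ?w\<bar> < 1" using inner_dir_less[of "i + num_verts K - 1"] w by simp
  have "to_prev K i \<bullet> edge_vec K i / (norm (to_prev K i) * norm (edge_vec K i)) = - (?u \<bullet> ?w)"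
    unfolding to_prev_eq[OF verts_pos] edge_vec_eq using len_pos[of i] len_pos[of "i + num_verts K - 1"]
    by simp
  then have "fold_angle K i = arccos (- (?u \<bullet> ?w))" by (simp add: fold_angle_def)
  then show "0 < fold_angle K i" "fold_angle K i < pi"
    using u arccos_lt_bounded[of "- (?u \<bullet> ?w)"] by auto
qed

lemma edge_eq: "edge K i = {pt K i 0 s | s. 0 \<le> s \<and> s \<le> len K i}"
proof -
  have "p \<in> edge K i \<longleftrightarrow> (\<exists>s. p = pt K i 0 s \<and> 0 \<le> s \<and> s \<le> len K i)" for p
  proof
    assume "p \<in> edge K i"
    then obtain t where t: "0 \<le> t" "t \<le> 1" "p = (1 - t) *\<^sub>R vertex K i + t *\<^sub>R vertex K (Suc i)"
      by (auto simp: edge_def in_segment)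
    then have "p = pt K i 0 (t * len K i)" by (simp add: pt_def vertex_Suc algebra_simps)
    moreover have "0 \<le> t * len K i" "t * len K i \<le> len K i"
      using t len_pos[of i] by (simp_all add: mult_le_cancel_right1)
    ultimately show "\<exists>s. p = pt K i 0 s \<and> 0 \<le> s \<and> s \<le> len K i" by blast
  next
    assume "\<exists>s. p = pt K i 0 s \<and> 0 \<le> s \<and> s \<le> len K i"
    then obtain s where s: "p = pt K i 0 s" "0 \<le> s" "s \<le> len K i" by blast
    have "p = (1 - s / len K i) *\<^sub>R vertex K i + (s / len K i) *\<^sub>R vertex K (Suc i)"
      using len_pos[of i] by (simp add: s(1) pt_def vertex_Suc algebra_simps)
    moreover have "0 \<le> s / len K i" "s / len K i \<le> 1" using s len_pos[of i] by simp_all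
    ultimately show "p \<in> edge K i" unfolding edge_def in_segment by blast
  qed
  then show ?thesis by auto
qed

end

section \<open>The topological type of the band\<close>

context ribbon
begin

section \<open>Arc length and the unfolding map\<close>

definition start :: "nat \<Rightarrow> real" where
  "start k = (\<Sum>j<k. len K j)"

lemma start_simps [simp]: "start 0 = 0" "start (Suc k) = start k + len K k"
  by (simp_all add: start_def)

lemma start_less: "i < j \<Longrightarrow> start i < start j"
  using lift_Suc_mono_less[of start i j] len_pos by simp

lemma start_le: "i \<le> j \<Longrightarrow> start i \<le> start j"
  using start_less[of i j] by (cases "i = j") auto

lemma ribbonlength_eq: "ribbonlength K = start (num_verts K)"
  by (simp add: ribbonlength_def start_def len_def edge_vec_def dist_norm norm_minus_commute)

lemma start_interval:
  assumes "0 \<le> y" "y \<le> start k" "k > 0"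
  obtains i where "i < k" "start i \<le> y" "y \<le> start (Suc i)"
proof -
  have "\<exists>i<k. start i \<le> y \<and> y \<le> start (Suc i)"
    using assms(2,3)
  proof (induction k)
    case (Suc k)
    show ?case
    proof (cases "y \<le> start k \<and> k > 0")
      case True
      then show ?thesis using Suc.IH less_Suc_eq by blast
    next
      case False
      then have "start k \<le> y" using assms(1) by auto
      then show ?thesis using Suc.prems by blast
    qed
  qed simp
  then show ?thesis using that by blast
qed

definition width :: "nat \<Rightarrow> real \<Rightarrow> real" where
  "width i x = len K i + (slant K i + slant K (Suc i)) * x"

text \<open>Straightens the trapezoid \<open>face K i\<close> to the rectangle of length \<open>len K i\<close>.\<close>

definition unfold :: "nat \<times> complex \<Rightarrow> real \<times> real" where
  "unfold = (\<lambda>(i, p). (1/2 + (-1) ^ i * offset K i p,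
     start i + len K i * ((along K i p + slant K i * offset K i p) / width i (offset K i p))))"

lemma unfold_start: "unfold (i, pt K i x (- slant K i * x)) = (1/2 + (-1) ^ i * x, start i)"
  by (simp add: unfold_def)

lemma unfold_end:
  assumes "\<bar>x\<bar> \<le> 1/2"
  shows "unfold (i, pt K i x (len K i + slant K (Suc i) * x)) = (1/2 + (-1) ^ i * x, start (Suc i))"
proof -
  have "len K i + slant K (Suc i) * x + slant K i * x = width i x"
    by (simp add: width_def algebra_simps)
  moreover have "width i x > 0" using width_pos[OF assms] by (simp add: width_def)
  ultimately show ?thesis by (simp only: unfold_def split offset_pt along_pt) simp
qed

text \<open>Inverse formulas for \<open>unfold\<close>: \<open>c\<close> is the fraction of the way
  from one crease to the next at the given offset.\<close>

lemma unfold_eq: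
  assumes "unfold (i, p) = (t, y)" "p \<in> face K i"
  obtains x c where "\<bar>x\<bar> \<le> 1/2" "0 \<le> c" "c \<le> 1" "p = pt K i x (c * width i x - slant K i * x)"
    "t = 1/2 + (-1) ^ i * x" "y = start i + len K i * c"
proof -
  define x where "x = offset K i p"
  define c where "c = (along K i p + slant K i * x) / width i x"
  have x: "\<bar>x\<bar> \<le> 1/2" "- slant K i * x \<le> along K i p" "along K i p \<le> len K i + slant K (Suc i) * x"
    using assms(2) by (auto simp: face_eq x_def)
  have w: "width i x > 0" using width_pos[OF x(1)] by (simp add: width_def)
  have "0 \<le> c" "c \<le> 1" using x w by (auto simp: c_def divide_simps) (auto simp: width_def algebra_simps)
  moreover have "c * width i x - slant K i * x = along K i p" using w by (simp add: c_def)
  then have "p = pt K i x (c * width i x - slant K i * x)" by (simp add: x_def)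
  moreover have "t = 1/2 + (-1) ^ i * x" "y = start i + len K i * c"
    using assms(1) by (auto simp: unfold_def x_def c_def)
  ultimately show ?thesis using that x(1) by blast
qed

lemma unfold_pt:
  assumes "\<bar>x\<bar> \<le> 1/2" "0 \<le> c" "c \<le> 1"
  shows "pt K i x (c * width i x - slant K i * x) \<in> face K i"
    and "unfold (i, pt K i x (c * width i x - slant K i * x)) = (1/2 + (-1) ^ i * x, start i + len K i * c)"
proof -
  have w: "width i x > 0" using width_pos[OF assms(1)] by (simp add: width_def)
  then have "0 \<le> c * width i x" "c * width i x \<le> width i x"
    using assms by (simp_all add: mult_le_cancel_right1)
  then show "pt K i x (c * width i x - slant K i * x) \<in> face K i"
    unfolding pt_in_face using assms by (simp add: width_def algebra_simps)
  show "unfold (i, pt K i x (c * width i x - slant K i * x)) = (1/2 + (-1) ^ i * x, start i + len K i * c)"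
    using w by (simp add: unfold_def)
qed

abbreviation "faces \<equiv> sum_topology (\<lambda>i. top_of_set (face K i)) {..<num_verts K}"

lemma compact_face: "compact (face K i)"
  by (auto simp: face_def fold_line_def intro!: compact_convex_hull)

text \<open>A continuous surjection of a compact space onto a Hausdorff space is a quotient map, and
  the faces are compact and finite in number.\<close>

lemma quotient_map_unfold:
  "quotient_map faces (top_of_set ({0..1} \<times> {0..ribbonlength K})) unfold"
proof (rule T1_Spaces.continuous_imp_quotient_map)
  show "compact_space faces"
    by (rule compact_space_sum_topology) (auto simp: compact_space_subtopology compact_face)
  show "Hausdorff_space (top_of_set ({0..1} \<times> {0..ribbonlength K}) :: (real \<times> real) topology)"
    by (simp add: Hausdorff_space_subtopology)
  show img: "unfold ` topspace faces = topspace (top_of_set ({0..1} \<times> {0..ribbonlength K}))"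
  proof (intro equalityI subsetI)
    fix q assume "q \<in> unfold ` topspace faces"
    then obtain i p where i: "i < num_verts K" "p \<in> face K i" "q = unfold (i, p)" by auto
    obtain t y where q: "q = (t, y)" by force
    obtain x c where h: "\<bar>x\<bar> \<le> 1/2" "0 \<le> c" "c \<le> 1" "t = 1/2 + (-1) ^ i * x" "y = start i + len K i * c"
      using unfold_eq[of i p t y] i q by metis
    have "len K i * c \<le> len K i" using h len_pos[of i] by (simp add: mult_le_cancel_left1)
    then have "0 \<le> y" "y \<le> start (Suc i)"
      using h start_le[of 0 i] len_pos[of i] by auto
    moreover have "start (Suc i) \<le> ribbonlength K" unfolding ribbonlength_eq using i by (intro start_le) simp
    moreover have "0 \<le> t" "t \<le> 1" using h by (cases "even i"; auto simp: abs_le_iff)+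
    ultimately show "q \<in> topspace (top_of_set ({0..1} \<times> {0..ribbonlength K}))" using q by auto
  next
    fix q assume "q \<in> topspace (top_of_set ({0..1} \<times> {0..ribbonlength K}) :: (real \<times> real) topology)"
    then obtain t y where q: "q = (t, y)" "0 \<le> t" "t \<le> 1" "0 \<le> y" "y \<le> start (num_verts K)"
      by (auto simp: ribbonlength_eq)
    obtain i where i: "i < num_verts K" "start i \<le> y" "y \<le> start (Suc i)"
      using start_interval[OF q(4,5) verts_pos] .
    define x c where "x = (-1) ^ i * (t - 1/2)" and "c = (y - start i) / len K i"
    have "\<bar>t - 1/2\<bar> \<le> 1/2" using q by linarith
    then have "\<bar>x\<bar> \<le> 1/2" by (simp add: x_def abs_mult)
    moreover have "0 \<le> c" "c \<le> 1" using i len_pos[of i] by (simp_all add: c_def divide_simps)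
    ultimately have "pt K i x (c * width i x - slant K i * x) \<in> face K i"
      "unfold (i, pt K i x (c * width i x - slant K i * x)) = (1/2 + (-1) ^ i * x, start i + len K i * c)"
      using unfold_pt by blast+
    moreover have "(1/2 + (-1) ^ i * x, start i + len K i * c) = q"
      using len_pos[of i] by (simp add: x_def c_def q flip: mult.assoc power_add mult_2)
    ultimately show "q \<in> unfold ` topspace faces" using i(1) by (force simp: image_iff)
  qed
  show "continuous_map faces (top_of_set ({0..1} \<times> {0..ribbonlength K})) unfold"
  proof (rule continuous_map_into_subtopology)
    show "continuous_map faces euclidean unfold"
    proof (rule continuous_map_sum_topology)
      fix i
      have "width i (offset K i p) \<noteq> 0" if "p \<in> face K i" for p
        using that width_pos[of "offset K i p" i] by (auto simp: face_eq width_def)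
      then have "continuous_on (face K i) (\<lambda>p. unfold (i, p))"
        unfolding unfold_def split
        by (auto intro!: continuous_intros simp: width_def offset_def along_def)
      then show "continuous_map (top_of_set (face K i)) euclidean (\<lambda>p. unfold (i, p))" by simp
    qed
    show "unfold \<in> topspace faces \<rightarrow> {0..1} \<times> {0..ribbonlength K}" using img by auto
  qed
qed

lemma fold_line_pair:
  assumes "p \<in> fold_line K (Suc i)"
  obtains x where "\<bar>x\<bar> \<le> 1/2" "p = pt K i x (len K i + slant K (Suc i) * x)"
    "p = pt K (Suc i) (- x) (- slant K (Suc i) * (- x))"
proof -
  obtain x where x: "\<bar>x\<bar> \<le> 1/2" "p = pt K i x (len K i + slant K (Suc i) * x)"
    using assms by (auto simp: fold_line_end)
  then have "p = pt K (Suc i) (- x) (- slant K (Suc i) * (- x))"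
    using fold_point[of i "- x"] by simp
  with x show ?thesis using that by blast
qed

section \<open>Creases and the seam of the unfolded strip\<close>

definition gluing :: "((nat \<times> complex) \<times> (nat \<times> complex)) set" where
  "gluing = {((i, x), (Suc i mod num_verts K, x)) | i x. i < num_verts K \<and> x \<in> fold_line K (Suc i)}"

text \<open>Each fold exchanges the sides of the centerline, so after one round the transverse
  coordinate comes back reversed exactly when the number of faces is odd.\<close>

definition closing :: "real \<Rightarrow> real" where
  "closing t = (if even (num_verts K) then t else 1 - t)"

definition band_ends :: "((real \<times> real) \<times> (real \<times> real)) set" where
  "band_ends = {((t, 0), (closing t, ribbonlength K)) | t. t \<in> {0..1}}"

lemma pt_mod [simp]: "pt K (i mod num_verts K) = pt K i"
  by (simp add: pt_def fun_eq_iff)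

text \<open>The crease between the last face and face \<open>0\<close> is the only one that
  \<open>unfold\<close> tears: its two copies go to opposite ends of the strip.\<close>

lemma unfold_seam:
  assumes "\<bar>x\<bar> \<le> 1/2"
  defines "p \<equiv> pt K 0 x (- slant K 0 * x)" and "k \<equiv> num_verts K - 1"
  shows "p \<in> face K 0" "p \<in> face K k" "((k, p), (0, p)) \<in> gluing"
    and "unfold (0, p) = (1/2 + x, 0)" "unfold (k, p) = (closing (1/2 + x), ribbonlength K)"
proof -
  have k: "Suc k = num_verts K" using verts_pos by (simp add: k_def)
  have p: "p = pt K (Suc k) x (- slant K (Suc k) * x)"
    using periodic(3,5)[of 0] by (simp add: p_def k)
  then have p': "p = pt K k (- x) (len K k + slant K (Suc k) * (- x))"
    using fold_point[of k x] by simp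
  have fold: "p \<in> fold_line K (Suc k)" using p' assms by (auto simp: fold_line_end intro!: exI[of _ "- x"])
  then show "p \<in> face K k" by (auto simp: face_def intro: hull_inc)
  have "p \<in> fold_line K 0" using assms(1) by (auto simp: p_def fold_line_start[of 0])
  then show "p \<in> face K 0" by (auto simp: face_def intro: hull_inc)
  show "((k, p), (0, p)) \<in> gluing" using fold k by (auto simp: gluing_def intro!: exI[of _ k])
  show "unfold (0, p) = (1/2 + x, 0)" unfolding p_def unfold_start by simp
  have "(-1) ^ k * (- x) = (if even (num_verts K) then x else - x)" by (simp flip: k)
  then show "unfold (k, p) = (closing (1/2 + x), ribbonlength K)"
    unfolding p' using unfold_end[of "- x" k] assms(1) k
    by (auto simp: closing_def ribbonlength_eq simp del: start_simps split: if_splits)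
qed

lemma unfold_gluing:
  assumes "(a, b) \<in> gluing"
  shows "(unfold a, unfold b) \<in> (band_ends \<union> band_ends\<inverse>)\<^sup>*"
proof -
  obtain i p where i: "i < num_verts K" "p \<in> fold_line K (Suc i)" "a = (i, p)" "b = (Suc i mod num_verts K, p)"
    using assms by (auto simp: gluing_def)
  note ab = i(3,4)
  obtain x where x: "\<bar>x\<bar> \<le> 1/2" "p = pt K i x (len K i + slant K (Suc i) * x)"
    "p = pt K (Suc i) (- x) (- slant K (Suc i) * (- x))"
    using fold_line_pair[OF i(2)] .
  have a: "unfold a = (1/2 + (-1) ^ i * x, start (Suc i))"
    unfolding i(3) x(2) using x(1) by (rule unfold_end)
  show ?thesis
  proof (cases "Suc i < num_verts K")
    \<comment> \<open>Away from the seam both copies have the same image, because the offset and the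
      factor \<open>(-1) ^ i\<close> change sign together.\<close>
    case True
    then have "unfold b = (1/2 + (-1) ^ Suc i * (- x), start (Suc i))"
      unfolding i(4) by (metis unfold_start x(3) mod_less)
    then show ?thesis using a by simp
  next
    case False
    then have si: "Suc i = num_verts K" using i by simp
    then have p: "p = pt K 0 (- x) (- slant K 0 * (- x))" using x(3) periodic(3,5)[of 0] by simp
    have i: "num_verts K - 1 = i" using si by simp
    have "\<bar>- x\<bar> \<le> 1/2" using x(1) by simp
    from unfold_seam(4,5)[OF this, folded p, unfolded i]
    have "unfold (0, p) = (1/2 + - x, 0)" "unfold (i, p) = (closing (1/2 + - x), ribbonlength K)" .
    moreover have "1/2 + - x \<in> {0..1}" using x(1) by (auto simp: abs_le_iff)
    ultimately have "(unfold (0, p), unfold (i, p)) \<in> band_ends" unfolding band_ends_def by auto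
    moreover have "b = (0, p)" using ab si by simp
    ultimately show ?thesis using ab by auto
  qed
qed

text \<open>The images of two different faces share at most an end value of the second coordinate.
  For \<open>i < j\<close>, equal images therefore put \<open>p\<close> on the final crease of face
  \<open>i\<close> and \<open>q\<close> on the initial crease of face \<open>j\<close>, and force
  \<open>j = Suc i\<close>.\<close>

lemma unfold_inj:
  assumes "a \<in> topspace faces" "b \<in> topspace faces" "unfold a = unfold b"
  shows "(a, b) \<in> (gluing \<union> gluing\<inverse>)\<^sup>*"
proof -
  have main: "((i, p), (j, q)) \<in> (gluing \<union> gluing\<inverse>)\<^sup>*"
    if ij: "i \<le> j" "i < num_verts K" "j < num_verts K" "p \<in> face K i" "q \<in> face K j"
      and eq: "unfold (i, p) = unfold (j, q)" for i j p q
  proof -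
    obtain t y where ty: "unfold (i, p) = (t, y)" by force
    obtain x c where x: "\<bar>x\<bar> \<le> 1/2" "0 \<le> c" "c \<le> 1" "p = pt K i x (c * width i x - slant K i * x)"
      "t = 1/2 + (-1) ^ i * x" "y = start i + len K i * c"
      using unfold_eq[OF ty ij(4)] .
    obtain x' c' where x': "\<bar>x'\<bar> \<le> 1/2" "0 \<le> c'" "c' \<le> 1" "q = pt K j x' (c' * width j x' - slant K j * x')"
      "t = 1/2 + (-1) ^ j * x'" "y = start j + len K j * c'"
      using unfold_eq[OF ty[unfolded eq] ij(5)] .
    show ?thesis
    proof (cases "i = j")
      case True
      then have "x = x'" "c = c'" using x x' len_pos[of i] by (auto split: if_splits)
      then show ?thesis using True x x' by simp
    next
      case False
      then have "start (Suc i) \<le> start j" using ij by (intro start_le) simp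
      moreover have "len K i * c \<le> len K i" using x len_pos[of i] by (simp add: mult_le_cancel_left1)
      moreover have "0 \<le> len K j * c'" using x' len_pos[of j] by simp
      ultimately have "len K i * c = len K i" "len K j * c' = 0" "start (Suc i) = start j"
        using x(6) x'(6) unfolding start_simps by linarith+
      moreover have "len K i \<noteq> 0" "len K j \<noteq> 0" using len_pos[of i] len_pos[of j] by auto
      ultimately have c: "c = 1" "c' = 0" and st: "start (Suc i) = start j" by simp_all
      have j: "j = Suc i" using st start_less[of "Suc i" j] ij False by fastforce
      have "x' = - x" using x(5) x'(5) j by (cases "even i") auto
      moreover have p: "p = pt K i x (len K i + slant K (Suc i) * x)"
        using x(4) c by (simp add: width_def algebra_simps)
      ultimately have "q = p" using x'(4) c j fold_point[of i "- x"] by simp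
      moreover have "p \<in> fold_line K (Suc i)" unfolding fold_line_end using p x(1) by blast
      ultimately have "((i, p), (j, q)) \<in> gluing" using ij j unfolding gluing_def by auto
      then show ?thesis by auto
    qed
  qed
  have sym: "(b, a) \<in> (gluing \<union> gluing\<inverse>)\<^sup>* \<Longrightarrow> (a, b) \<in> (gluing \<union> gluing\<inverse>)\<^sup>*" for a b
    using equiv_generated[of gluing] by (meson equivE symE)
  obtain i p j q where "a = (i, p)" "b = (j, q)" by force
  then show ?thesis
    using main[of i j p q] sym[OF main[of j i q p]] assms by (cases "i \<le> j") auto
qed

lemma band_homeomorphic:
  "band K homeomorphic_space glue (top_of_set ({0..1} \<times> {0..ribbonlength K})) band_ends"
  unfolding band_def gluing_def[symmetric]
proof (rule homeomorphic_glue[OF quotient_map_unfold], rule glue_relation_pullback)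
  fix a b assume "(a, b) \<in> gluing"
  then show "(unfold a, unfold b) \<in> (band_ends \<union> band_ends\<inverse>)\<^sup>*" by (rule unfold_gluing)
next
  fix a b assume "(a, b) \<in> band_ends"
  then obtain t where t: "0 \<le> t" "t \<le> 1" "a = (t, 0)" "b = (closing t, ribbonlength K)"
    by (auto simp: band_ends_def)
  \<comment> \<open>The point with transverse coordinate \<open>t\<close> on the initial crease of
    face \<open>0\<close>.\<close>
  define p where "p = pt K 0 (t - 1/2) (- slant K 0 * (t - 1/2))"
  let ?k = "num_verts K - 1"
  have x: "\<bar>t - 1/2\<bar> \<le> 1/2" using t unfolding abs_le_iff by linarith
  note seam = unfold_seam[OF x, folded p_def]
  have "(0, p) \<in> topspace faces" "(?k, p) \<in> topspace faces" using seam verts_pos by auto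
  moreover have "unfold (0, p) = a" "unfold (?k, p) = b" using seam t by auto
  moreover have "((0, p), (?k, p)) \<in> (gluing \<union> gluing\<inverse>)\<^sup>*" using seam(3) by auto
  ultimately show "\<exists>x x'. x \<in> topspace faces \<and> x' \<in> topspace faces \<and> unfold x = a \<and> unfold x' = b \<and>
      (x, x') \<in> (gluing \<union> gluing\<inverse>)\<^sup>*" by blast
qed (use unfold_inj in blast)+

lemma topological_annulus_if_even:
  assumes "even (num_verts K)"
  shows "topological_annulus K"
  using band_homeomorphic assms
  by (simp add: topological_annulus_def annulus_def band_ends_def closing_def)

lemma topological_mobius_band_if_odd:
  assumes "odd (num_verts K)"
  shows "topological_mobius_band K"
  using band_homeomorphic assms
  by (simp add: topological_mobius_band_def mobius_band_def band_ends_def closing_def)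

end

section \<open>The linking number of an embedded centerline\<close>

lemma eventually_at_right_mult_less:
  fixes a b :: real
  assumes "0 < b"
  shows "\<forall>\<^sub>F x in at_right 0. a * x < b"
proof -
  have "((\<lambda>x. a * x) \<longlongrightarrow> a * 0) (at_right 0)" by (intro tendsto_intros)
  then show ?thesis using assms by (auto dest: order_tendstoD(2))
qed

text \<open>The layering does not depend on the point of the plane. Adjacent edges meet in their
  common vertex alone because of \<open>turning\<close>.\<close>

locale embedded_ribbon = ribbon +
  fixes h :: "nat \<Rightarrow> int"
  assumes above_iff: "above K p i j \<longleftrightarrow> h j < h i"
    and heights_inj: "inj_on h {..<num_verts K}"
    and disjoint_edges: "i < num_verts K \<Longrightarrow> j < num_verts K \<Longrightarrow> i \<noteq> j \<Longrightarrow>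
      j \<noteq> Suc i mod num_verts K \<Longrightarrow> i \<noteq> Suc j mod num_verts K \<Longrightarrow> edge K i \<inter> edge K j = {}"
begin

definition turn :: "nat \<Rightarrow> real" where
  "turn k = cross2 (dir K k) (dir K (Suc k))"

lemma turn_nonzero [simp]: "turn k \<noteq> 0"
  using turning by (simp add: turn_def)

text \<open>The common sign of all crossings at the fold from face \<open>k\<close> to the next one:
  \<open>turn k\<close> is the cross product of the incoming with the outgoing direction, and it is
  reversed if the outgoing face is the upper one.\<close>

definition fold_sign :: "nat \<Rightarrow> real" where
  "fold_sign k = (if h (Suc k mod num_verts K) < h k then sgn (turn k) else - sgn (turn k))"

lemma passes_unique:
  assumes "(i, s) \<in> passes K p" "(j, t) \<in> passes K p"
  shows "(i, s) = (j, t)"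
proof -
  have p: "i < num_verts K" "0 \<le> s" "s < 1" "vertex K i + s *\<^sub>R edge_vec K i = p"
    "j < num_verts K" "0 \<le> t" "t < 1" "vertex K j + t *\<^sub>R edge_vec K j = p"
    using assms by (auto simp: passes_def)
  have mem: "p \<in> edge K i" "p \<in> edge K j"
    using p by (auto simp: edge_def in_segment edge_vec_def algebra_simps)
  have adjacent: False
    if "j = Suc i mod num_verts K" "s < 1" "0 \<le> t" "vertex K i + s *\<^sub>R edge_vec K i = p"
      "vertex K j + t *\<^sub>R edge_vec K j = p" for i j s t
  proof -
    have "vertex K (Suc i) + t *\<^sub>R edge_vec K (Suc i) = p" using that by simp
    moreover have "vertex K (Suc i) = vertex K i + edge_vec K i" by (simp add: edge_vec_def)
    ultimately have "vertex K i + (edge_vec K i + t *\<^sub>R edge_vec K (Suc i)) = vertex K i + s *\<^sub>R edge_vec K i"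
      using that(4) by (simp only: add.assoc)
    then have "(1 - s) *\<^sub>R edge_vec K i + t *\<^sub>R edge_vec K (Suc i) = 0"
      by (simp add: scaleR_diff_left diff_add_eq)
    \<comment> \<open>The cross product with the second direction removes the term in
      \<open>t\<close>; as \<open>s < 1\<close>, the turning would have to vanish.\<close>
    then have "cross2 ((1 - s) *\<^sub>R edge_vec K i + t *\<^sub>R edge_vec K (Suc i)) (dir K (Suc i)) = 0"
      by (simp add: cross2_eq)
    then have "(1 - s) * len K i * turn i = 0"
      unfolding edge_vec_eq turn_def by (simp add: cross2_eq algebra_simps)
    then show False using that(2) len_pos[of i] by simp
  qed
  consider "i = j" | "j = Suc i mod num_verts K" | "i = Suc j mod num_verts K"
    using disjoint_edges[OF p(1,5)] mem by auto
  then show ?thesis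
  proof cases
    case 1
    then have "s *\<^sub>R edge_vec K i = t *\<^sub>R edge_vec K i" using p(4,8) by (metis add_left_cancel)
    then have "s = t" using scaleR_right_imp_eq[OF edge_nonzero] by blast
    then show ?thesis using 1 by simp
  next
    case 2
    then show ?thesis using adjacent p by blast
  next
    case 3
    then show ?thesis using adjacent p by blast
  qed
qed

lemma centerline_ok: "centerline_ok K"
proof -
  have "finite (passes K p) \<and> card (passes K p) \<le> 1" for p
  proof (cases "passes K p = {}")
    case False
    then obtain a where "a \<in> passes K p" by blast
    then have "passes K p = {a}" using passes_unique by (metis is_singletonI' is_singleton_def singletonD surj_pair empty_iff)
    then show ?thesis by simp
  qed simp
  note one = this
  have "card (passes K p) \<noteq> 2" for p using one[of p] by linarith
  then have none: "{p. card (passes K p) = 2} = {}" by blast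
  have "vertex K i \<noteq> vertex K (Suc i)" for i using edge_nonzero[of i] by (auto simp: edge_vec_def)
  moreover have "finite (passes K p) \<and> card (passes K p) \<le> 2" for p using one[of p] by linarith
  ultimately show ?thesis
    unfolding centerline_ok_def none using three fold_angle_bounds passes_unique by blast
qed

text \<open>With an odd number of faces the parallel curve runs through every face twice, once on
  each side; with an even number it runs through once, on alternating sides.\<close>

definition offsets :: "real \<Rightarrow> real \<Rightarrow> nat \<Rightarrow> real set" where
  "offsets \<sigma> \<delta> k = {x. \<bar>x\<bar> = \<delta> \<and> (odd (num_verts K) \<or> x = (-1) ^ k * \<sigma> * \<delta>)}"

lemma minus_one_power_mod:
  assumes "even (num_verts K)"
  shows "(-1 :: real) ^ (k mod num_verts K) = (-1) ^ k"
  using assms by (simp add: minus_one_power_iff dvd_mod_iff)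

lemma parallel_curve_iff:
  assumes "\<sigma> \<in> {1, -1}" "\<delta> > 0"
  shows "(j, p) \<in> parallel_curve K \<sigma> \<delta> \<longleftrightarrow>
    j < num_verts K \<and> p \<in> face K j \<and> offset K j p \<in> offsets \<sigma> \<delta> j"
proof
  assume "(j, p) \<in> parallel_curve K \<sigma> \<delta>"
  then obtain k where k: "j = k mod num_verts K" "p \<in> face K k" "offset K k p = (-1) ^ k * \<sigma> * \<delta>"
    by (auto simp: parallel_curve_def)
  have "\<bar>(-1) ^ k * \<sigma> * \<delta>\<bar> = \<delta>" using assms by (auto simp: abs_mult)
  then show "j < num_verts K \<and> p \<in> face K j \<and> offset K j p \<in> offsets \<sigma> \<delta> j"
    using k verts_pos minus_one_power_mod[of k] by (auto simp: offsets_def)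
next
  assume j: "j < num_verts K \<and> p \<in> face K j \<and> offset K j p \<in> offsets \<sigma> \<delta> j"
  show "(j, p) \<in> parallel_curve K \<sigma> \<delta>"
  proof (cases "offset K j p = (-1) ^ j * \<sigma> * \<delta>")
    case True
    then show ?thesis using j by (auto simp: parallel_curve_def intro!: exI[of _ j])
  next
    case False
    then have odd: "odd (num_verts K)" and "\<bar>offset K j p\<bar> = \<delta>" using j by (auto simp: offsets_def)
    \<comment> \<open>The second round: an odd number of faces reverses the sign at the same
      face.\<close>
    then have eq: "offset K j p = (-1) ^ (j + num_verts K) * \<sigma> * \<delta>"
      using False assms by (cases "even j") (auto simp: abs_if split: if_splits)
    have "offset K (j + num_verts K) = offset K j" "face K (j + num_verts K) = face K j"
      by (metis mods(6) mod_add_self2, metis mods(13) mod_add_self2)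
    then show ?thesis
      using j eq by (auto simp: parallel_curve_def intro!: exI[of _ "j + num_verts K"])
  qed
qed

lemma offsets_Suc: "- x \<in> offsets \<sigma> \<delta> (Suc k mod num_verts K) \<longleftrightarrow> x \<in> offsets \<sigma> \<delta> k"
proof -
  have "- x = (-1) ^ (Suc k mod num_verts K) * \<sigma> * \<delta> \<longleftrightarrow> x = (-1) ^ k * \<sigma> * \<delta>"
    if "even (num_verts K)"
    unfolding minus_one_power_mod[OF that] by auto
  then show ?thesis by (auto simp: offsets_def)
qed

text \<open>The centerline edges \<open>k\<close> and \<open>Suc k\<close> and the parallel strand that is at offset \<open>x\<close> in face \<open>k\<close>
  and at offset \<open>- x\<close> in face \<open>Suc k\<close> form two wedges that are translates of each other along the
  fold line, so they cross exactly once.\<close>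

definition fold_crossing :: "nat \<Rightarrow> real \<Rightarrow> nat \<times> nat \<times> complex" where
  "fold_crossing k x = (if x * turn k > 0
     then (Suc k mod num_verts K, k, pt K (Suc k) 0 (x / turn k))
     else (k, Suc k mod num_verts K, pt K k 0 (len K k + x / turn k)))"

section \<open>Crossings near the folds\<close>

lemma coords_next:
  "offset K k (pt K (Suc k) 0 c) = c * turn k"
  "along K k (pt K (Suc k) 0 c) = len K k + c * (dir K k \<bullet> dir K (Suc k))"
proof -
  have eq: "pt K (Suc k) 0 c - vertex K k = len K k *\<^sub>R dir K k + c *\<^sub>R dir K (Suc k)"
    by (simp add: pt_def vertex_Suc)
  have "dir K k \<bullet> (\<i> * dir K k) = 0" "dir K (Suc k) \<bullet> (\<i> * dir K k) = turn k"
    by (simp_all add: inner_complex_def turn_def cross2_eq)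
  then show "offset K k (pt K (Suc k) 0 c) = c * turn k"
    unfolding offset_def eq dir_def[symmetric] by (simp add: inner_add_left)
  show "along K k (pt K (Suc k) 0 c) = len K k + c * (dir K k \<bullet> dir K (Suc k))"
    unfolding along_def eq by (simp add: inner_add_left inner_commute[of "dir K (Suc k)"])
qed

lemma coords_prev:
  "offset K (Suc k) (pt K k 0 (len K k + c)) = - (c * turn k)"
  "along K (Suc k) (pt K k 0 (len K k + c)) = c * (dir K k \<bullet> dir K (Suc k))"
proof -
  have eq: "pt K k 0 (len K k + c) - vertex K (Suc k) = c *\<^sub>R dir K k"
    by (simp add: pt_def vertex_Suc algebra_simps)
  have "dir K k \<bullet> (\<i> * dir K (Suc k)) = - turn k"
    by (simp add: inner_complex_def turn_def cross2_eq)
  then show "offset K (Suc k) (pt K k 0 (len K k + c)) = - (c * turn k)"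
    unfolding offset_def eq dir_def[symmetric] by simp
  show "along K (Suc k) (pt K k 0 (len K k + c)) = c * (dir K k \<bullet> dir K (Suc k))"
    unfolding along_def eq by simp
qed

text \<open>For the turning angle \<tau> this is cot(\<tau>/2) sin \<tau> = 1 + cos \<tau>.\<close>

lemma slant_turn: "slant K (Suc k) * turn k = 1 + dir K k \<bullet> dir K (Suc k)"
proof -
  define D where "D = dir K k \<bullet> dir K (Suc k)"
  have "1 - D \<noteq> 0" using inner_dir_less[of k] by (auto simp: D_def)
  moreover have "turn k * turn k = (1 - D) * (1 + D)"
    using inner_cross2_squares[of "dir K k" "dir K (Suc k)"]
    by (simp add: D_def turn_def power2_eq_square algebra_simps)
  ultimately show ?thesis
    unfolding slant_Suc[OF verts_pos] D_def[symmetric] turn_def[symmetric] by (simp add: field_simps)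
qed

text \<open>The crossings at fold \<open>k\<close> lie at distance \<delta> divided by the absolute
  value of \<open>turn k\<close> from the vertex. The first bounds keep them on their edge and short
  of the far crease of the face that carries the strand; the last one keeps strands away from edges
  that are not adjacent.\<close>

definition small :: "real \<Rightarrow> bool" where
  "small \<delta> \<longleftrightarrow> 0 < \<delta> \<and> \<delta> \<le> 1/2 \<and>
     (\<forall>k<num_verts K. (1 / \<bar>turn k\<bar> + \<bar>slant K k\<bar>) * \<delta> < len K k \<and>
        (1 / \<bar>turn k\<bar>) * \<delta> < len K (Suc k) \<and> (1 / \<bar>turn k\<bar>) * \<delta> < len K k \<and>
        (1 / \<bar>turn k\<bar> + \<bar>slant K (Suc (Suc k))\<bar>) * \<delta> < len K (Suc k)) \<and>
     (\<forall>i<num_verts K. \<forall>j<num_verts K. i \<noteq> j \<longrightarrow> j \<noteq> Suc i mod num_verts K \<longrightarrow> i \<noteq> Suc j mod num_verts K \<longrightarrow>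
        (1 + \<bar>slant K j\<bar> + \<bar>slant K (Suc j)\<bar>) * \<delta> < setdist (edge K i) (edge K j))"

lemma eventually_small: "\<forall>\<^sub>F \<delta> in at_right 0. small \<delta>"
proof -
  have pos: "\<forall>\<^sub>F \<delta> in at_right (0::real). 0 < \<delta>" by (simp add: eventually_at_right_less)
  have half: "\<forall>\<^sub>F \<delta> in at_right (0::real). \<delta> \<le> 1/2"
    using eventually_at_right_mult_less[of "1/2" 1] by (auto elim: eventually_mono)
  have local: "\<forall>\<^sub>F \<delta> in at_right 0. \<forall>k\<in>{..<num_verts K}. (1 / \<bar>turn k\<bar> + \<bar>slant K k\<bar>) * \<delta> < len K k \<and>
        (1 / \<bar>turn k\<bar>) * \<delta> < len K (Suc k) \<and> (1 / \<bar>turn k\<bar>) * \<delta> < len K k \<and>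
        (1 / \<bar>turn k\<bar> + \<bar>slant K (Suc (Suc k))\<bar>) * \<delta> < len K (Suc k)"
    by (intro eventually_ball_finite ballI eventually_conj eventually_at_right_mult_less len_pos) simp
  have far: "\<forall>\<^sub>F \<delta> in at_right 0. i \<noteq> j \<longrightarrow> j \<noteq> Suc i mod num_verts K \<longrightarrow> i \<noteq> Suc j mod num_verts K \<longrightarrow>
        (1 + \<bar>slant K j\<bar> + \<bar>slant K (Suc j)\<bar>) * \<delta> < setdist (edge K i) (edge K j)"
    if "i < num_verts K" "j < num_verts K" for i j
  proof (cases "i \<noteq> j \<and> j \<noteq> Suc i mod num_verts K \<and> i \<noteq> Suc j mod num_verts K")
    case True
    then have "edge K i \<inter> edge K j = {}" using that disjoint_edges by blast
    then have "setdist (edge K i) (edge K j) > 0"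
      by (simp add: setdist_gt_0_compact_closed edge_def)
    then show ?thesis using eventually_at_right_mult_less by (auto elim: eventually_mono)
  qed (auto intro: always_eventually)
  have "\<forall>\<^sub>F \<delta> in at_right 0. \<forall>i\<in>{..<num_verts K}. \<forall>j\<in>{..<num_verts K}.
      i \<noteq> j \<longrightarrow> j \<noteq> Suc i mod num_verts K \<longrightarrow> i \<noteq> Suc j mod num_verts K \<longrightarrow>
        (1 + \<bar>slant K j\<bar> + \<bar>slant K (Suc j)\<bar>) * \<delta> < setdist (edge K i) (edge K j)"
    using far by (intro eventually_ball_finite ballI) auto
  then show ?thesis using pos half local
    by eventually_elim (simp add: small_def)
qed

lemma fold_crossing_mem:
  assumes small: "small \<delta>" and \<sigma>: "\<sigma> \<in> {1, -1}" and k: "k < num_verts K" and x: "x \<in> offsets \<sigma> \<delta> k"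
  shows "fold_crossing k x \<in> crossings K \<sigma> \<delta>"
proof -
  \<comment> \<open>\<open>c\<close> is the signed position of the crossing relative to the vertex:
    positive on the outgoing edge, negative on the incoming one.\<close>
  define c D where "c = x / turn k" and "D = dir K k \<bullet> dir K (Suc k)"
  have \<delta>: "0 < \<delta>" "\<delta> \<le> 1/2" "\<bar>x\<bar> = \<delta>" using small x by (auto simp: small_def offsets_def)
  have s: "(1 / \<bar>turn k\<bar> + \<bar>slant K k\<bar>) * \<delta> < len K k" "(1 / \<bar>turn k\<bar>) * \<delta> < len K (Suc k)"
    "(1 / \<bar>turn k\<bar>) * \<delta> < len K k" "(1 / \<bar>turn k\<bar> + \<bar>slant K (Suc (Suc k))\<bar>) * \<delta> < len K (Suc k)"
    using small k unfolding small_def by blast+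
  have x_eq: "x = c * turn k" by (simp add: c_def)
  have c_abs: "\<bar>c\<bar> = (1 / \<bar>turn k\<bar>) * \<delta>" using \<delta> by (simp add: c_def)
  have D: "\<bar>D\<bar> < 1" using inner_dir_less by (simp add: D_def)
  have cD: "\<bar>c * D\<bar> \<le> \<bar>c\<bar>" using D by (simp add: abs_mult mult_left_le)
  have sx: "\<bar>slant K j * x\<bar> = \<bar>slant K j\<bar> * \<delta>" for j using \<delta> by (simp add: abs_mult)
  define A B E where "A = slant K k * x" and "B = slant K (Suc (Suc k)) * x" and "E = c * D"
  have A: "\<bar>c\<bar> + \<bar>A\<bar> < len K k" using s(1) unfolding c_abs A_def sx by (simp add: distrib_right)
  have B: "\<bar>c\<bar> + \<bar>B\<bar> < len K (Suc k)" using s(4) unfolding c_abs B_def sx by (simp add: distrib_right)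
  have E: "\<bar>E\<bar> \<le> \<bar>c\<bar>" using cD by (simp add: E_def)
  \<comment> \<open>At this offset the crease deviates by \<open>c + c * D\<close> from the
    perpendicular through the vertex, the crossing only by \<open>c * D\<close>. The difference
    \<open>c\<close> has the sign that leaves the crossing inside the face.\<close>
  have slx: "slant K (Suc k) * x = c + c * D"
  proof -
    have "slant K (Suc k) * x = c * (slant K (Suc k) * turn k)" by (simp add: x_eq)
    also have "\<dots> = c + c * D" unfolding slant_turn D_def by (simp add: distrib_left)
    finally show ?thesis .
  qed
  show ?thesis
  proof (cases "x * turn k > 0")
    case True
    then have c: "c > 0" by (simp add: c_def zero_less_divide_iff zero_less_mult_iff)
    let ?p = "pt K (Suc k) 0 c"
    have "0 \<le> c" "c \<le> len K (Suc k)" using c c_abs s(2) by linarith+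
    then have "?p \<in> edge K (Suc k)" unfolding edge_eq by blast
    then have 1: "?p \<in> edge K (Suc k mod num_verts K)" by simp
    have off: "offset K k ?p = x" by (simp add: coords_next x_eq)
    have "?p \<in> face K k"
      unfolding face_eq mem_Collect_eq off coords_next(2) D_def[symmetric]
      unfolding slx mult_minus_left A_def[symmetric] E_def[symmetric] using A E \<delta> c by linarith
    then have "(k, ?p) \<in> parallel_curve K \<sigma> \<delta>"
      unfolding parallel_curve_iff[OF \<sigma> \<delta>(1)] off using k x by blast
    with 1 True verts_pos show ?thesis by (simp add: fold_crossing_def crossings_def c_def)
  next
    case False
    have "x \<noteq> 0" using \<delta> by auto
    then have c: "c < 0" using False by (simp add: c_def divide_less_0_iff zero_less_mult_iff not_less) (metis linorder_neqE turn_nonzero order.asym not_le order_less_le)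
    let ?p = "pt K k 0 (len K k + c)"
    have "0 \<le> len K k + c" "len K k + c \<le> len K k" using c c_abs s(3) by linarith+
    then have 1: "?p \<in> edge K k" unfolding edge_eq by blast
    have off: "offset K (Suc k) ?p = - x" by (simp add: coords_prev x_eq)
    have "?p \<in> face K (Suc k)"
      unfolding face_eq mem_Collect_eq off coords_prev(2) D_def[symmetric]
      unfolding mult_minus_right mult_minus_left minus_minus slx B_def[symmetric] E_def[symmetric]
      using B E \<delta> c by linarith
    then have "(Suc k mod num_verts K, ?p) \<in> parallel_curve K \<sigma> \<delta>"
      unfolding parallel_curve_iff[OF \<sigma> \<delta>(1)] using k x off verts_pos offsets_Suc by simp
    with 1 False k show ?thesis by (simp add: fold_crossing_def crossings_def c_def)
  qed
qed

lemma near_edge: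
  assumes "p \<in> face K j"
  obtains q where "q \<in> edge K j" "dist p q \<le> (1 + \<bar>slant K j\<bar> + \<bar>slant K (Suc j)\<bar>) * \<bar>offset K j p\<bar>"
proof -
  define x s where "x = offset K j p" and "s = along K j p"
  have h: "- slant K j * x \<le> s" "s \<le> len K j + slant K (Suc j) * x"
    using assms by (auto simp: face_eq x_def s_def)
  \<comment> \<open>The nearest parameter of the edge; the slants bound how far the face extends
    beyond the ends of its edge.\<close>
  define t where "t = max 0 (min s (len K j))"
  have t: "0 \<le> t" "t \<le> len K j" using len_pos[of j] by (auto simp: t_def)
  have "\<bar>slant K i * x\<bar> = \<bar>slant K i\<bar> * \<bar>x\<bar>" for i by (simp add: abs_mult)
  then have "\<bar>s - t\<bar> \<le> \<bar>slant K j\<bar> * \<bar>x\<bar> + \<bar>slant K (Suc j)\<bar> * \<bar>x\<bar>"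
    using h len_pos[of j] abs_ge_self[of "slant K j * x"] abs_ge_minus_self[of "slant K j * x"]
      abs_ge_self[of "slant K (Suc j) * x"] abs_ge_minus_self[of "slant K (Suc j) * x"]
    by (auto simp: t_def max_def min_def)
  moreover have "dist p (pt K j 0 t) \<le> \<bar>x\<bar> + \<bar>s - t\<bar>"
  proof -
    have "p = pt K j x s" by (simp add: x_def s_def)
    then have "p - pt K j 0 t = x *\<^sub>R (\<i> * dir K j) + (s - t) *\<^sub>R dir K j"
      by (simp add: pt_def algebra_simps)
    then show ?thesis
      using norm_triangle_ineq[of "x *\<^sub>R (\<i> * dir K j)" "(s - t) *\<^sub>R dir K j"]
      by (simp add: dist_norm norm_mult)
  qed
  ultimately have "dist p (pt K j 0 t) \<le> (1 + \<bar>slant K j\<bar> + \<bar>slant K (Suc j)\<bar>) * \<bar>offset K j p\<bar>"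
    by (simp add: x_def algebra_simps)
  moreover have "pt K j 0 t \<in> edge K j" unfolding edge_eq using t by blast
  ultimately show ?thesis using that by blast
qed

text \<open>The strand in face \<open>j\<close> stays close to edge \<open>j\<close>, so edge
  \<open>i\<close> is equal or adjacent to it, and equality is excluded by the nonzero offset. For
  adjacent edges, the offset is up to sign \<open>turn\<close> times the position on edge
  \<open>i\<close> relative to the common vertex.\<close>

lemma crossing_is_fold_crossing:
  assumes small: "small \<delta>" and \<sigma>: "\<sigma> \<in> {1, -1}" and c: "(i, j, p) \<in> crossings K \<sigma> \<delta>"
  obtains k x where "k < num_verts K" "x \<in> offsets \<sigma> \<delta> k" "(i, j, p) = fold_crossing k x"
proof -
  have \<delta>: "0 < \<delta>" using small by (simp add: small_def)
  have i: "i < num_verts K" "p \<in> edge K i" and pc: "(j, p) \<in> parallel_curve K \<sigma> \<delta>"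
    using c by (auto simp: crossings_def)
  have j: "j < num_verts K" "p \<in> face K j" "offset K j p \<in> offsets \<sigma> \<delta> j"
    using pc unfolding parallel_curve_iff[OF \<sigma> \<delta>] by auto
  have off: "\<bar>offset K j p\<bar> = \<delta>" using j by (simp add: offsets_def)
  obtain q where q: "q \<in> edge K j" "dist p q \<le> (1 + \<bar>slant K j\<bar> + \<bar>slant K (Suc j)\<bar>) * \<delta>"
    using near_edge[OF j(2)] off by metis
  have "setdist (edge K i) (edge K j) \<le> dist p q" using i(2) q(1) by (rule setdist_le_dist)
  then have "\<not> (1 + \<bar>slant K j\<bar> + \<bar>slant K (Suc j)\<bar>) * \<delta> < setdist (edge K i) (edge K j)" using q(2) by linarith
  then consider "i = j" | "j = Suc i mod num_verts K" | "i = Suc j mod num_verts K"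
    using small i(1) j(1) unfolding small_def by blast
  then show ?thesis
  proof cases
    case 1
    then have "offset K j p = 0" using i(2) by (auto simp: edge_eq)
    then show ?thesis using off \<delta> by simp
  next
    case 2
    obtain s where s: "p = pt K i 0 s" "s \<le> len K i" using i(2) by (auto simp: edge_eq)
    define x where "x = - offset K j p"
    have x: "x \<in> offsets \<sigma> \<delta> i" using j(3) unfolding x_def 2 using offsets_Suc[of x] by (simp add: x_def 2)
    have "offset K j p = - ((s - len K i) * turn i)"
      using coords_prev(1)[of i "s - len K i"] by (simp add: 2 s(1))
    then have x_eq: "x = (s - len K i) * turn i" by (simp add: x_def)
    then have "x * turn i = (s - len K i) * (turn i * turn i)" by simp
    also have "\<dots> \<le> 0" using s(2) by (intro mult_nonpos_nonneg) auto
    finally have "\<not> x * turn i > 0" by simp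
    moreover have "len K i + x / turn i = s" by (simp add: x_eq)
    ultimately have "(i, j, p) = fold_crossing i x" by (simp add: fold_crossing_def 2 s(1))
    then show ?thesis using that i(1) x by blast
  next
    case 3
    have "p \<in> edge K (Suc j)" using i(2) by (simp add: 3)
    then obtain s where s: "p = pt K (Suc j) 0 s" "0 \<le> s" by (auto simp: edge_eq)
    define x where "x = offset K j p"
    have x_eq: "x = s * turn j" by (simp add: x_def s(1) coords_next)
    then have "s > 0" using off \<delta> s(2) x_def by (cases "s = 0") auto
    moreover have "turn j * turn j > 0" by (metis not_real_square_gt_zero turn_nonzero)
    ultimately have "x * turn j > 0" by (simp add: x_eq mult.assoc)
    moreover have "x / turn j = s" by (simp add: x_eq)
    ultimately have "(i, j, p) = fold_crossing j x" by (simp add: fold_crossing_def 3 s(1))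
    then show ?thesis using that j x_def by blast
  qed
qed

lemma Suc_mod_neq: "k < num_verts K \<Longrightarrow> Suc k mod num_verts K \<noteq> k"
  using three by (cases "Suc k = num_verts K") (auto simp: mod_less)

text \<open>The ordered pair of faces determines the fold unless each face is the successor of the
  other, which three vertices exclude. At a given fold, the position determines
  \<open>x\<close>.\<close>

lemma fold_crossing_inj: "inj_on (\<lambda>(k, x). fold_crossing k x) ({..<num_verts K} \<times> UNIV)"
proof -
  have two: False if "k < num_verts K" "l < num_verts K" "l = Suc k mod num_verts K" "k = Suc l mod num_verts K" for k l
  proof -
    have "l = 0 \<and> Suc k = num_verts K \<or> l = Suc k"
      using that(1,3) by (cases "Suc k = num_verts K") auto
    moreover have "k = 0 \<and> Suc l = num_verts K \<or> k = Suc l"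
      using that(2,4) by (cases "Suc l = num_verts K") auto
    ultimately show False using three by linarith
  qed
  show ?thesis
  proof (rule inj_onI, clarsimp)
    fix k x l y assume k: "k < num_verts K" "l < num_verts K" and eq: "fold_crossing k x = fold_crossing l y"
    have neq: "\<not> (l = Suc k mod num_verts K \<and> k = Suc l mod num_verts K)" using two[OF k] by blast
    show "k = l \<and> x = y"
    proof (cases "x * turn k > 0 \<longleftrightarrow> y * turn l > 0")
      case True
      then have "k = l" using eq by (auto simp: fold_crossing_def split: if_splits)
      then show ?thesis using True eq by (auto simp: fold_crossing_def split: if_splits)
    next
      case False
      then have "l = Suc k mod num_verts K \<and> k = Suc l mod num_verts K"
        using eq unfolding fold_crossing_def by (metis prod.inject)
      then show ?thesis using neq by blast
    qed
  qed
qed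

text \<open>The sign depends only on the directions of the upper and the lower strand, hence not on
  which of the two belongs to the centerline.\<close>

lemma crossing_sign_fold_crossing:
  assumes "k < num_verts K"
  shows "crossing_sign K (fold_crossing k x) = fold_sign k"
proof -
  have sg: "sgn (cross2 (edge_vec K k) (edge_vec K (Suc k))) = sgn (turn k)"
    "sgn (cross2 (edge_vec K (Suc k)) (edge_vec K k)) = - sgn (turn k)"
    using len_pos[of k] len_pos[of "Suc k"] cross2_commute[of "dir K k" "dir K (Suc k)"]
    by (simp_all add: edge_vec_eq cross2_scaleR sgn_mult turn_def sgn_minus)
  have "h (Suc k mod num_verts K) \<noteq> h k"
    using inj_onD[OF heights_inj, of "Suc k mod num_verts K" k] Suc_mod_neq[OF assms] assms verts_pos by auto
  then show ?thesis
    by (auto simp: crossing_sign_def fold_crossing_def fold_sign_def above_iff sg)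
qed

text \<open>The parallel curve passes each fold once or twice according to the parity, and every
  passage contributes \<open>fold_sign\<close>.\<close>

lemma crossings_sum:
  assumes "small \<delta>" "\<sigma> \<in> {1, -1}"
  shows "finite (crossings K \<sigma> \<delta>)"
    and "(\<Sum>c\<in>crossings K \<sigma> \<delta>. crossing_sign K c) =
      (if even (num_verts K) then 1 else 2) * (\<Sum>k<num_verts K. fold_sign k)"
proof -
  have \<delta>: "\<delta> > 0" using assms by (simp add: small_def)
  let ?S = "Sigma {..<num_verts K} (offsets \<sigma> \<delta>)"
  have eq: "crossings K \<sigma> \<delta> = (\<lambda>(k, x). fold_crossing k x) ` ?S"
  proof
    show "crossings K \<sigma> \<delta> \<subseteq> (\<lambda>(k, x). fold_crossing k x) ` ?S"
    proof clarify
      fix i j p assume "(i, j, p) \<in> crossings K \<sigma> \<delta>"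
      then obtain k x where kx: "k < num_verts K" "x \<in> offsets \<sigma> \<delta> k" "(i, j, p) = fold_crossing k x"
        using crossing_is_fold_crossing[OF assms] by blast
      show "(i, j, p) \<in> (\<lambda>(k, x). fold_crossing k x) ` ?S"
        unfolding kx(3) using kx(1,2) by (intro image_eqI[of _ _ "(k, x)"]) auto
    qed
  qed (use fold_crossing_mem[OF assms] in auto)
  have offs: "offsets \<sigma> \<delta> k = (if even (num_verts K) then {(-1) ^ k * \<sigma> * \<delta>} else {\<delta>, - \<delta>})" for k
    using assms(2) \<delta> by (auto simp: offsets_def abs_mult)
  have card: "finite (offsets \<sigma> \<delta> k)" "card (offsets \<sigma> \<delta> k) = (if even (num_verts K) then 1 else 2)" for k
    using \<delta> by (auto simp: offs card_insert_if)
  have inj: "inj_on (\<lambda>(k, x). fold_crossing k x) ?S"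
    by (rule inj_on_subset[OF fold_crossing_inj]) auto
  show "finite (crossings K \<sigma> \<delta>)" unfolding eq using card by (intro finite_imageI finite_SigmaI) auto
  have "(\<Sum>c\<in>crossings K \<sigma> \<delta>. crossing_sign K c) = (\<Sum>(k, x)\<in>?S. crossing_sign K (fold_crossing k x))"
    unfolding eq sum.reindex[OF inj] by (simp add: case_prod_unfold)
  also have "\<dots> = (\<Sum>k<num_verts K. \<Sum>x\<in>offsets \<sigma> \<delta> k. crossing_sign K (fold_crossing k x))"
    using card by (intro sum.Sigma[symmetric]) auto
  also have "\<dots> = (\<Sum>k<num_verts K. (if even (num_verts K) then 1 else 2) * fold_sign k)"
    by (intro sum.cong) (simp_all add: crossing_sign_fold_crossing card)
  finally show "(\<Sum>c\<in>crossings K \<sigma> \<delta>. crossing_sign K c) =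
      (if even (num_verts K) then 1 else 2) * (\<Sum>k<num_verts K. fold_sign k)"
    by (simp add: sum_distrib_left)
qed

lemma has_linking_number:
  "has_ribbon_linking_number K
     ((if even (num_verts K) then 1/2 else 1) * (\<Sum>k<num_verts K. fold_sign k))"
  unfolding has_ribbon_linking_number_def
proof
  fix \<sigma> :: real assume "\<sigma> \<in> {1, -1}"
  then show "\<forall>\<^sub>F \<delta> in at_right 0. finite (crossings K \<sigma> \<delta>) \<and>
      (\<Sum>c\<in>crossings K \<sigma> \<delta>. crossing_sign K c) / 2 =
      (if even (num_verts K) then 1/2 else 1) * (\<Sum>k<num_verts K. fold_sign k)"
    using crossings_sum by (intro eventually_mono[OF eventually_small]) auto
qed

end

section \<open>Layering by heights\<close>

text \<open>A face whose creases lie in a closed half-plane has its interior in the open one, so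
  \<open>S\<close> may touch the border line. Explicit coefficients reduce all later uses to linear
  arithmetic in the coordinates.\<close>

lemma interior_face_separated:
  assumes "(\<alpha>, \<beta>) \<noteq> (0, 0)"
    and "\<And>p. p \<in> fold_line K i \<or> p \<in> fold_line K (Suc i) \<Longrightarrow> \<alpha> * Re p + \<beta> * Im p \<le> c"
    and "\<And>p. p \<in> S \<Longrightarrow> c \<le> \<alpha> * Re p + \<beta> * Im p"
  shows "S \<inter> interior (face K i) = {}"
proof -
  let ?a = "Complex \<alpha> \<beta>"
  have "face K i \<subseteq> {p. ?a \<bullet> p \<le> c}"
    unfolding face_def
  proof (rule hull_minimal)
    show "fold_line K i \<union> fold_line K (Suc i) \<subseteq> {p. ?a \<bullet> p \<le> c}"
      using assms(2) by (auto simp: inner_complex_def)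
  qed (rule convex_halfspace_le)
  moreover have "?a \<noteq> 0" using assms(1) by (auto simp: complex_eq_iff)
  ultimately have "interior (face K i) \<subseteq> {p. ?a \<bullet> p < c}"
    using interior_mono interior_halfspace_le by metis
  then show ?thesis using assms(3) by (force simp: inner_complex_def)
qed

lemma edges_separated:
  assumes "\<alpha> * Re (vertex K i) + \<beta> * Im (vertex K i) \<le> c"
    "\<alpha> * Re (vertex K (Suc i)) + \<beta> * Im (vertex K (Suc i)) \<le> c"
    "c < \<alpha> * Re (vertex K j) + \<beta> * Im (vertex K j)"
    "c < \<alpha> * Re (vertex K (Suc j)) + \<beta> * Im (vertex K (Suc j))"
  shows "edge K i \<inter> edge K j = {}"
proof -
  let ?a = "Complex \<alpha> \<beta>"
  have "edge K i \<subseteq> {p. ?a \<bullet> p \<le> c}"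
    unfolding edge_def using assms(1,2)
    by (intro closed_segment_subset convex_halfspace_le) (auto simp: inner_complex_def)
  moreover have "edge K j \<subseteq> {p. ?a \<bullet> p > c}"
    unfolding edge_def using assms(3,4)
    by (intro closed_segment_subset convex_halfspace_gt) (auto simp: inner_complex_def)
  ultimately show ?thesis by force
qed

text \<open>The heights settle the order axioms, so a crease only has to miss the faces strictly
  between the two that it joins. Interleaving cannot arise when no two creases share a
  segment.\<close>

lemma (in embedded_ribbon) folded_ribbon_knotI:
  assumes through: "\<And>k r. k < num_verts K \<Longrightarrow> r < num_verts K \<Longrightarrow>
      h k < h r \<and> h r < h (Suc k mod num_verts K) \<or> h (Suc k mod num_verts K) < h r \<and> h r < h k \<Longrightarrow>
      fold_line K (Suc k) \<inter> interior (face K r) = {}"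
    and overlap: "\<And>k l a b. k < num_verts K \<Longrightarrow> l < num_verts K \<Longrightarrow> k \<noteq> l \<Longrightarrow>
      {a, b} \<subseteq> fold_line K k \<inter> fold_line K l \<Longrightarrow> a = b"
  shows "folded_ribbon_knot K"
  unfolding folded_ribbon_knot_def
proof (intro conjI)
  show "centerline_ok K" by (rule centerline_ok)
  show "\<forall>i<num_verts K. fold_line K i \<inter> fold_line K (Suc i) = {}" by (simp add: fold_lines_disjoint)
  show "strict_layer_order K"
    unfolding strict_layer_order_def
  proof (intro allI conjI)
    fix p
    show "irreflp_on (sheets K p) (above K p)" by (auto simp: irreflp_on_def above_iff)
    show "transp_on (sheets K p) (above K p)" by (auto simp: transp_on_def above_iff)
    show "totalp_on (sheets K p) (above K p)"
      using heights_inj by (auto simp: totalp_on_def above_iff sheets_def inj_on_def) (metis lessThan_iff linorder_neqE)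
  qed
  show "locally_constant_order K" by (auto simp: locally_constant_order_def above_iff)
  show "no_sheet_through_fold K"
    unfolding no_sheet_through_fold_def
  proof (intro allI impI ballI)
    fix k r z
    assume k: "k < num_verts K" "r < num_verts K"
      and z: "z \<in> fold_line_interior K (Suc k) \<inter> interior (face K r)"
    have "z \<in> fold_line K (Suc k) \<inter> interior (face K r)"
      using z by (auto simp: fold_line_interior_def fold_line_def open_segment_def)
    then have "\<not> (h k < h r \<and> h r < h (Suc k mod num_verts K) \<or> h (Suc k mod num_verts K) < h r \<and> h r < h k)"
      using through[OF k] by blast
    then have "\<not> between K p r k (Suc k mod num_verts K)" for p
      by (auto simp: between_def above_iff)
    then show "\<forall>\<^sub>F p in nhds z. {k, Suc k mod num_verts K} \<subseteq> sheets K p \<longrightarrow>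
        \<not> between K p r k (Suc k mod num_verts K)" by simp
  qed
  show "no_fold_through_fold K"
    unfolding no_fold_through_fold_def
  proof (intro allI impI, elim conjE)
    fix k l and a b :: complex
    assume kl: "k < num_verts K" "l < num_verts K" "k \<noteq> l" "a \<noteq> b"
      and sub: "closed_segment a b \<subseteq> fold_line K (Suc k) \<inter> fold_line K (Suc l)"
    \<comment> \<open>The layering condition numbers creases by \<open>Suc k\<close>; reduction
      modulo the number of faces leads back to the numbering in \<open>overlap\<close>.\<close>
    have "Suc k mod num_verts K \<noteq> Suc l mod num_verts K"
      using kl by (cases "Suc k = num_verts K"; cases "Suc l = num_verts K") auto
    moreover have "{a, b} \<subseteq> fold_line K (Suc k mod num_verts K) \<inter> fold_line K (Suc l mod num_verts K)"
      using sub by auto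
    ultimately have "a = b" using overlap verts_pos by (metis mod_less_divisor)
    then show "\<forall>z\<in>open_segment a b. \<forall>\<^sub>F p in nhds z.
        {k, Suc k mod num_verts K, l, Suc l mod num_verts K} \<subseteq> sheets K p \<longrightarrow>
        \<not> interleaved K p k (Suc k mod num_verts K) l (Suc l mod num_verts K)" using kl by simp
  qed
qed

lemma ribbonI:
  assumes m: "3 \<le> num_verts K"
    and "\<And>i. i < num_verts K \<Longrightarrow> edge_vec K i \<noteq> 0"
    and "\<And>i. i < num_verts K \<Longrightarrow> cross2 (dir K i) (dir K (Suc i)) \<noteq> 0"
    and "\<And>i. i < num_verts K \<Longrightarrow> \<bar>slant K i + slant K (Suc i)\<bar> < 2 * len K i"
  shows "ribbon K"
proof
  have pos: "num_verts K > 0" using m by linarith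
  then have i: "i mod num_verts K < num_verts K" for i by simp
  show "3 \<le> num_verts K" by (rule m)
  show "edge_vec K i \<noteq> 0" for i
    using assms(2)[OF i] by (simp add: edge_vec_mod[OF pos])
  show "cross2 (dir K i) (dir K (Suc i)) \<noteq> 0" for i
    using assms(3)[OF i] by (simp add: dir_mod[OF pos] dir_Suc_mod[OF pos])
  show "\<bar>slant K i + slant K (Suc i)\<bar> < 2 * len K i" for i
    using assms(4)[OF i] by (simp add: slant_mod[OF pos] slant_Suc_mod[OF pos] len_mod[OF pos])
qed

lemma dir_lenI:
  assumes "edge_vec K i = c *\<^sub>R u" "c > 0" "norm u = 1"
  shows "dir K i = u" "len K i = c" "edge_vec K i \<noteq> 0"
  using assms by (auto simp: dir_def len_def sgn_div_norm)

section \<open>Ribbons wound around a stick\<close>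

text \<open>The zigzag has the vertices \<open>0, \<dots>, T\<close>, alternately right and left of the stick, at distances
  from its axis that grow slightly, and it climbs to height \<open>3/2\<close>. The edge lengths of the closing part
  are determined by its directions and by the abscissa \<open>-3/4\<close> of its outer vertices.\<close>

definition radius :: "nat \<Rightarrow> nat \<Rightarrow> real" where
  "radius T k = (2 * real k + 1) / (real T * (real T + 1))"

text \<open>The radii are proportional to odd numbers, so at slope \<open>3/4\<close> the single
  climbs are proportional to 1, 2, 3, ... and add up to triangular numbers.\<close>

definition level :: "nat \<Rightarrow> nat \<Rightarrow> real" where
  "level T k = 3/2 * (real k * (real k + 1)) / (real T * (real T + 1))"

definition pleat :: "nat \<Rightarrow> nat \<Rightarrow> complex" where
  "pleat T k = Complex ((-1) ^ k * radius T k) (level T k)"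

definition descent :: "nat \<Rightarrow> real" where
  "descent T = 21/8 + 3/4 * radius T T + 3/4 * radius T 0"

definition upper :: "nat \<Rightarrow> complex" where
  "upper T = Complex (-3/4) (33/16 + 3/4 * radius T T)"

text \<open>Half way down, and moved to the right so that the two edges of this detour have
  directions (5, -12) and (-5, -12) up to scale. It is the extra vertex of the annulus.\<close>

definition notch :: "nat \<Rightarrow> complex" where
  "notch T = Complex (5/24 * descent T - 3/4) (33/16 + 3/4 * radius T T - descent T / 2)"

definition lower :: "nat \<Rightarrow> complex" where
  "lower T = Complex (-3/4) (- (9/16 + 3/4 * radius T 0))"

definition last_face :: "bool \<Rightarrow> nat \<Rightarrow> nat" where
  "last_face b T = (if b then T + 3 else T + 2)"

text \<open>The spiral starts at face \<open>s\<close>. Up to sign, the height of a face is its position, so each face is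
  outermost among the earlier ones; the last face is the strand that enters the stick.\<close>

definition height :: "bool \<Rightarrow> nat \<Rightarrow> nat \<Rightarrow> nat \<Rightarrow> int" where
  "height b T s i = (if i = last_face b T then 0
     else if s \<le> i \<and> (even i \<or> T \<le> i) then int i + 1 else - (int i + 1))"

definition wound :: "bool \<Rightarrow> nat \<Rightarrow> nat \<Rightarrow> folded_ribbon" where
  "wound b T s =
     \<lparr>verts = map (pleat T) [0..<Suc T] @ upper T # (if b then [notch T] else []) @ [lower T],
      above = (\<lambda>p i j. height b T s j < height b T s i)\<rparr>"

text \<open>\<open>s_ge\<close> makes the stick thin, and \<open>climb\<close> puts crease
  \<open>s\<close> at level \<open>5/4\<close> or higher. With even \<open>T\<close> the zigzag ends
  on the right, so the exit edge crosses the stick towards the outer vertices; with even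
  \<open>s\<close> the spiral starts with a face on top.\<close>

locale winding =
  fixes b :: bool and T s :: nat and K :: folded_ribbon and M :: nat
  assumes K_eq: "K = wound b T s" and last_eq: "M = last_face b T"
    and even_T: "even T" and even_s: "even s" and s_le: "s \<le> T" and s_ge: "24 \<le> s"
    and climb: "5 * (real T * (real T + 1)) \<le> 6 * (real s * (real s + 1))"
begin

section \<open>Size of the zigzag\<close>

abbreviation "r \<equiv> radius T"
abbreviation "y \<equiv> level T"

lemma T_ge: "24 \<le> T" using s_le s_ge by linarith

lemma denom_pos: "0 < real T * (real T + 1)" using T_ge by simp

lemma r_pos: "0 < r k"
  using denom_pos by (simp add: radius_def)

lemma r_less: "i < j \<Longrightarrow> r i < r j"
  using denom_pos by (auto simp: radius_def divide_strict_right_mono)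

lemma r_le: "i \<le> j \<Longrightarrow> r i \<le> r j"
  using r_less[of i j] by (cases "i = j") auto

lemma r_T: "r T \<le> 1/12"
proof -
  have "(2 * real T + 1) * 12 \<le> real T * (real T + 1)"
  proof -
    have "24 * (real T + 1) \<le> real T * (real T + 1)" using T_ge by (intro mult_right_mono) auto
    then show ?thesis by simp
  qed
  then show ?thesis using denom_pos by (simp add: radius_def divide_simps)
qed

lemma r_0: "r 0 \<le> 1/12"
  using r_le[of 0 T] r_T by simp

lemma y_0 [simp]: "y 0 = 0" by (simp add: level_def)

lemma y_T [simp]: "y T = 3/2"
proof -
  have "real T * (real T + 1) \<noteq> 0" using denom_pos by linarith
  from nonzero_mult_div_cancel_right[OF this, of "3/2"] show ?thesis unfolding level_def .
qed

lemma y_Suc: "y (Suc k) = y k + 3/4 * (r k + r (Suc k))"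
proof -
  have "3/2 * (real (Suc k) * (real (Suc k) + 1)) =
      3/2 * (real k * (real k + 1)) + 3/4 * ((2 * real k + 1) + (2 * real (Suc k) + 1))"
    by (simp add: algebra_simps)
  moreover have "r k + r (Suc k) = ((2 * real k + 1) + (2 * real (Suc k) + 1)) / (real T * (real T + 1))"
    by (simp only: radius_def add_divide_distrib)
  ultimately show ?thesis
    by (simp only: level_def times_divide_eq_right flip: add_divide_distrib)
qed

lemma y_less: "i < j \<Longrightarrow> y i < y j"
  using lift_Suc_mono_less[of y i j] y_Suc r_pos by (simp add: add_pos_pos)

lemma y_le: "i \<le> j \<Longrightarrow> y i \<le> y j"
  using y_less[of i j] by (cases "i = j") auto

text \<open>\<open>5/4\<close> is twice the half-length \<open>5/8\<close> of a pleat crease: a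
  crease centered this high stays above level \<open>5/8\<close>, where crease \<open>0\<close> of
  the entering strand ends.\<close>

lemma y_s: "5/4 \<le> y s"
  using denom_pos climb by (simp add: level_def divide_simps)

section \<open>Vertices, directions and slants\<close>

lemma num_verts_K: "num_verts K = Suc M"
  by (simp add: K_eq last_eq wound_def last_face_def)

lemma M_eq: "b \<Longrightarrow> M = Suc (Suc (Suc T))" "\<not> b \<Longrightarrow> M = Suc (Suc T)"
  by (simp_all add: last_eq last_face_def)

lemma M_gt: "T < M" "Suc T < M"
  by (simp_all add: last_eq last_face_def)

lemma vertex_nth: "i \<le> M \<Longrightarrow> vertex K i = verts K ! i"
  using num_verts_K by (simp add: vertex_def)

lemma vertex_pleat: "i \<le> T \<Longrightarrow> vertex K i = pleat T i"
  using vertex_nth[of i] M_gt by (simp add: K_eq wound_def nth_append del: upt_Suc)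

lemma vertex_upper: "vertex K (Suc T) = upper T"
  using vertex_nth[of "Suc T"] M_gt by (simp add: K_eq wound_def nth_append del: upt_Suc)

lemma vertex_notch: "b \<Longrightarrow> vertex K (Suc (Suc T)) = notch T"
  using vertex_nth[of "Suc (Suc T)"] M_eq by (simp add: K_eq wound_def nth_append del: upt_Suc)

lemma vertex_lower: "vertex K M = lower T"
  using vertex_nth[of M] M_eq by (cases b) (simp_all add: K_eq wound_def nth_append del: upt_Suc)

lemma vertex_wrap: "vertex K (Suc M) = pleat T 0"
  using vertex_pleat[of 0] num_verts_K by (simp add: vertex_def)

text \<open>All edges have Pythagorean directions, so that the fold lines have rational slopes.\<close>

lemma edge_pleat:
  assumes "k < T"
  shows "edge_vec K k = (5/4 * (r k + r (Suc k))) *\<^sub>R Complex ((-1) ^ Suc k * (4/5)) (3/5)"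
  using assms y_Suc[of k]
  by (simp add: edge_vec_def vertex_pleat pleat_def complex_eq_iff algebra_simps)

lemma edge_exit: "edge_vec K T = (5/4 * (r T + 3/4)) *\<^sub>R Complex ((-1) ^ Suc T * (4/5)) (3/5)"
  using even_T by (simp add: edge_vec_def vertex_pleat vertex_upper pleat_def upper_def complex_eq_iff algebra_simps)

lemma edge_entry: "edge_vec K M = (5/4 * (r 0 + 3/4)) *\<^sub>R Complex (4/5) (3/5)"
  by (simp add: edge_vec_def vertex_wrap vertex_lower pleat_def lower_def complex_eq_iff algebra_simps)

lemma edge_down: "\<not> b \<Longrightarrow> edge_vec K (Suc T) = descent T *\<^sub>R Complex 0 (-1)"
  using vertex_lower
  by (simp add: edge_vec_def vertex_upper M_eq upper_def lower_def descent_def complex_eq_iff algebra_simps)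

lemma edge_in: "b \<Longrightarrow> edge_vec K (Suc T) = (13/24 * descent T) *\<^sub>R Complex (5/13) (-12/13)"
  by (simp add: edge_vec_def vertex_upper vertex_notch upper_def notch_def complex_eq_iff algebra_simps)

lemma edge_out:
  assumes b
  shows "edge_vec K (Suc (Suc T)) = (13/24 * descent T) *\<^sub>R Complex (-5/13) (-12/13)"
proof -
  have "vertex K (Suc (Suc (Suc T))) = lower T" using vertex_lower assms by (simp add: M_eq)
  moreover have "- (9/16 + 3/4 * radius T 0) - (33/16 + 3/4 * radius T T - descent T / 2) = - (descent T / 2)"
    by (simp add: descent_def field_simps)
  ultimately show ?thesis
    using assms by (simp add: edge_vec_def vertex_notch notch_def lower_def complex_eq_iff)
qed

lemma descent_bounds: "21/8 < descent T" "descent T \<le> 11/4"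
  using r_pos[of T] r_pos[of 0] r_T r_0 by (simp_all add: descent_def)

lemma norm_pythagorean:
  "norm (Complex ((-1) ^ Suc k * (4/5)) (3/5)) = 1" "norm (Complex (4/5) (3/5)) = 1"
  "norm (Complex 0 (-1)) = 1" "norm (Complex (5/13) (-12/13)) = 1" "norm (Complex (-5/13) (-12/13)) = 1"
  by (simp_all add: complex_norm power_mult_distrib power2_eq_square flip: power_mult power_add)

lemma dir_pleat:
  assumes "k \<le> T"
  shows "dir K k = Complex ((-1) ^ Suc k * (4/5)) (3/5)"
    and "len K k = 5/4 * (r k + (if k = T then 3/4 else r (Suc k)))" and "edge_vec K k \<noteq> 0"
  using dir_lenI[OF edge_pleat[of k] _ norm_pythagorean(1)] dir_lenI[OF edge_exit _ norm_pythagorean(1)]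
    assms r_pos[of k] r_pos[of "Suc k"] by (cases "k = T"; simp)+

lemma dir_entry: "dir K M = Complex (4/5) (3/5)" "len K M = 5/4 * (r 0 + 3/4)" "edge_vec K M \<noteq> 0"
  using dir_lenI[OF edge_entry _ norm_pythagorean(2)] r_pos[of 0] by simp_all

lemma dir_down:
  assumes "\<not> b"
  shows "dir K (Suc T) = Complex 0 (-1)" "len K (Suc T) = descent T" "edge_vec K (Suc T) \<noteq> 0"
  using dir_lenI[OF edge_down[OF assms] _ norm_pythagorean(3)] descent_bounds by simp_all

lemma dir_in:
  assumes b
  shows "dir K (Suc T) = Complex (5/13) (-12/13)" "len K (Suc T) = 13/24 * descent T" "edge_vec K (Suc T) \<noteq> 0"
  using dir_lenI[OF edge_in[OF assms] _ norm_pythagorean(4)] descent_bounds by simp_all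

lemma dir_out:
  assumes b
  shows "dir K (Suc (Suc T)) = Complex (-5/13) (-12/13)" "len K (Suc (Suc T)) = 13/24 * descent T"
    "edge_vec K (Suc (Suc T)) \<noteq> 0"
  using dir_lenI[OF edge_out[OF assms] _ norm_pythagorean(5)] descent_bounds by simp_all

lemma verts_nonempty: "num_verts K > 0" using num_verts_K by simp

lemma dir_wrap: "dir K (Suc M) = dir K 0"
  using dir_mod[OF verts_nonempty, of "Suc M"] num_verts_K by simp

lemmas slant_next = slant_Suc[OF verts_nonempty]

lemma slant_pleat:
  assumes "k \<le> T"
  shows "slant K k = (-1) ^ k * (3/4)"
proof (cases k)
  case 0
  have "slant K 0 = slant K (Suc M)"
    using slant_mod[OF verts_nonempty, of "Suc M"] num_verts_K by simp
  also have "\<dots> = 3/4"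
    by (simp add: slant_next dir_wrap dir_entry dir_pleat cross2_eq inner_complex_def)
  finally show ?thesis using 0 by simp
next
  case (Suc j)
  then show ?thesis using assms
    by (simp add: slant_next dir_pleat cross2_eq inner_complex_def)
qed

lemma slant_wrap: "slant K (Suc M) = 3/4"
  using slant_mod[OF verts_nonempty, of "Suc M"] num_verts_K slant_pleat[of 0] by simp

lemma slant_upper: "slant K (Suc T) = (if b then 3/11 else 1/2)"
  using even_T by (simp add: slant_next dir_pleat dir_down dir_in cross2_eq inner_complex_def)

lemma slant_notch: "b \<Longrightarrow> slant K (Suc (Suc T)) = - (12/5)"
  by (simp add: slant_next dir_in dir_out cross2_eq inner_complex_def)

lemma slant_lower: "slant K M = (if b then 3/11 else 1/2)"
  using dir_entry(1)
  by (cases b) (simp_all add: M_eq slant_next dir_down dir_out cross2_eq inner_complex_def)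

lemma index_cases [consumes 1, case_names pleat exit down "in" out entry]:
  assumes "i < num_verts K"
  obtains "i < T" | "i = T" | "\<not> b" "i = Suc T" | b "i = Suc T" | b "i = Suc (Suc T)" | "i = M"
  using assms num_verts_K by (cases b) (auto simp: M_eq less_Suc_eq)

lemma turning_values:
  "k < T \<Longrightarrow> cross2 (dir K k) (dir K (Suc k)) = - ((-1) ^ k) * (24/25)"
  "cross2 (dir K T) (dir K (Suc T)) = (if b then 33/65 else 4/5)"
  "\<not> b \<Longrightarrow> cross2 (dir K (Suc T)) (dir K (Suc (Suc T))) = 4/5"
  "b \<Longrightarrow> cross2 (dir K (Suc T)) (dir K (Suc (Suc T))) = - (120/169)"
  "b \<Longrightarrow> cross2 (dir K (Suc (Suc T))) (dir K (Suc (Suc (Suc T)))) = 33/65"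
  "cross2 (dir K M) (dir K (Suc M)) = 24/25"
  using dir_entry(1) even_T
  by (auto simp: dir_wrap dir_pleat dir_down dir_in dir_out M_eq cross2_eq)

end

sublocale winding \<subseteq> ribbon K
proof (rule ribbonI)
  show "3 \<le> num_verts K" using num_verts_K M_gt T_ge by linarith
next
  fix i assume i: "i < num_verts K"
  then show "edge_vec K i \<noteq> 0"
    by (cases rule: index_cases) (simp_all add: dir_pleat dir_entry dir_down dir_in dir_out)
  from i show "cross2 (dir K i) (dir K (Suc i)) \<noteq> 0"
    by (cases rule: index_cases) (simp_all add: turning_values)
  from i show "\<bar>slant K i + slant K (Suc i)\<bar> < 2 * len K i"
  proof (cases rule: index_cases)
    case pleat
    then show ?thesis using r_pos[of i] r_pos[of "Suc i"] by (simp add: slant_pleat dir_pleat)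
  next
    case exit
    then show ?thesis using even_T r_pos[of T] by (simp add: slant_pleat slant_upper dir_pleat)
  next
    case down
    then show ?thesis using descent_bounds slant_lower by (simp add: slant_upper dir_down M_eq)
  next
    case "in"
    then show ?thesis using descent_bounds by (simp add: slant_upper slant_notch dir_in)
  next
    case out
    then show ?thesis using descent_bounds slant_lower by (simp add: slant_notch dir_out M_eq)
  next
    case entry
    then show ?thesis using r_pos[of 0] by (simp add: slant_lower slant_wrap dir_entry)
  qed
qed

context winding
begin

abbreviation "h \<equiv> height b T s"

section \<open>Position of the creases and edges\<close>

lemma fold_lineE:
  assumes "p \<in> fold_line K k"
  obtains x where "\<bar>x\<bar> \<le> 1/2"
    "Re p = Re (vertex K k) - x * (slant K k * Re (dir K k) + Im (dir K k))"
    "Im p = Im (vertex K k) + x * (Re (dir K k) - slant K k * Im (dir K k))"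
proof -
  obtain x where "\<bar>x\<bar> \<le> 1/2" "p = pt K k x (- slant K k * x)"
    using assms by (auto simp: fold_line_start)
  then show ?thesis by (intro that[of x]) (simp_all only: pt_def, simp_all add: algebra_simps)
qed

text \<open>The bisectors along the zigzag are horizontal, so the creases are vertical; their
  half-length is 1 / (2 * 4/5) = 5/8.\<close>

lemma fold_pleat:
  assumes "p \<in> fold_line K k" "k \<le> T"
  shows "Re p = (-1) ^ k * r k" "\<bar>Im p - y k\<bar> \<le> 5/8"
proof -
  obtain x where x: "\<bar>x\<bar> \<le> 1/2"
    "Re p = Re (vertex K k) - x * (slant K k * Re (dir K k) + Im (dir K k))"
    "Im p = Im (vertex K k) + x * (Re (dir K k) - slant K k * Im (dir K k))"
    using fold_lineE[OF assms(1)] .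
  have sq: "(-1) ^ k * (-1) ^ k = (1::real)" by (simp flip: power_add mult_2)
  have 1: "slant K k * Re (dir K k) + Im (dir K k) = 0"
    using assms(2) sq by (simp add: slant_pleat dir_pleat algebra_simps)
  show "Re p = (-1) ^ k * r k" unfolding x(2) 1 using assms(2) by (simp add: vertex_pleat pleat_def)
  have 2: "Re (dir K k) - slant K k * Im (dir K k) = (-1) ^ k * - (5/4)"
    using assms(2) by (simp add: slant_pleat dir_pleat)
  show "\<bar>Im p - y k\<bar> \<le> 5/8"
    unfolding x(3) 2 using assms(2) x(1) by (simp add: vertex_pleat pleat_def abs_mult)
qed

lemma fold_upper:
  assumes "p \<in> fold_line K (Suc T)"
  obtains x where "\<bar>x\<bar> \<le> 1/2" "Re p = Re (upper T) + x * (if b then 9/11 else 1)"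
    "Im p = Im (upper T) + x * (if b then 7/11 else 1/2)"
proof -
  obtain x where "\<bar>x\<bar> \<le> 1/2"
    "Re p = Re (vertex K (Suc T)) - x * (slant K (Suc T) * Re (dir K (Suc T)) + Im (dir K (Suc T)))"
    "Im p = Im (vertex K (Suc T)) + x * (Re (dir K (Suc T)) - slant K (Suc T) * Im (dir K (Suc T)))"
    using fold_lineE[OF assms] .
  then show ?thesis
    by (intro that[of x]; cases b; simp add: vertex_upper slant_upper dir_in dir_down)
qed

lemma fold_notch:
  assumes "p \<in> fold_line K (Suc (Suc T))" b
  obtains x where "\<bar>x\<bar> \<le> 1/2" "Re p = Re (notch T)" "Im p = Im (notch T) - 13/5 * x"
proof -
  obtain x where "\<bar>x\<bar> \<le> 1/2"
    "Re p = Re (vertex K (Suc (Suc T))) - x * (slant K (Suc (Suc T)) * Re (dir K (Suc (Suc T))) + Im (dir K (Suc (Suc T))))"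
    "Im p = Im (vertex K (Suc (Suc T))) + x * (Re (dir K (Suc (Suc T))) - slant K (Suc (Suc T)) * Im (dir K (Suc (Suc T))))"
    using fold_lineE[OF assms(1)] .
  then show ?thesis using assms(2)
    by (intro that[of x]; simp add: vertex_notch slant_notch dir_out)
qed

lemma fold_lower:
  assumes "p \<in> fold_line K M"
  obtains x where "\<bar>x\<bar> \<le> 1/2" "Re p = Re (lower T) - x * (if b then 9/11 else 1)"
    "Im p = Im (lower T) + x * (if b then 7/11 else 1/2)"
proof -
  obtain x where "\<bar>x\<bar> \<le> 1/2"
    "Re p = Re (vertex K M) - x * (slant K M * Re (dir K M) + Im (dir K M))"
    "Im p = Im (vertex K M) + x * (Re (dir K M) - slant K M * Im (dir K M))"
    using fold_lineE[OF assms] .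
  then show ?thesis
    by (intro that[of x]; cases b; simp add: vertex_lower slant_lower dir_entry)
qed

lemma fold_wrap: "fold_line K (Suc M) = fold_line K 0"
  using mods(11)[of "Suc M"] num_verts_K by simp

lemma vertex_bounds:
  "k \<le> T \<Longrightarrow> \<bar>Re (vertex K k)\<bar> \<le> 1/12" "k \<le> T \<Longrightarrow> Im (vertex K k) = y k"
  "Re (upper T) = -3/4" "33/16 < Im (upper T)"
  "Re (notch T) < -1/6" "3/4 - 1/32 \<le> Im (notch T)" "Im (notch T) \<le> 3/4 + 1/32"
  "Re (lower T) = -3/4" "Im (lower T) < -9/16"
  using r_pos[of k] r_pos[of T] r_pos[of 0] r_le[of k T] r_T r_0 descent_bounds
  by (simp_all add: vertex_pleat pleat_def upper_def notch_def lower_def descent_def abs_mult field_simps)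

text \<open>A horizontal or a vertical line always separates: zigzag edges that are not adjacent
  occupy disjoint ranges of level, and the descending part stays left of the stick.\<close>

lemma edges_apart:
  assumes "i < j" "j \<le> M" "j \<noteq> Suc i" "i = 0 \<Longrightarrow> j \<noteq> M"
  shows "edge K i \<inter> edge K j = {}"
proof -
  have "j < num_verts K" using assms num_verts_K by simp
  then show ?thesis
  proof (cases rule: index_cases)
    case pleat
    then have "y i < y (Suc i)" "y (Suc i) < y j" "y j < y (Suc j)"
      using assms by (auto intro: y_less)
    then show ?thesis using pleat assms
      by (intro edges_separated[where \<alpha> = 0 and \<beta> = 1 and c = "y (Suc i)"]) (simp_all add: vertex_bounds)
  next
    case exit
    then have "Suc i < T" using assms by simp
    then have "y i < y (Suc i)" "y (Suc i) < 3/2" using y_less[of i "Suc i"] y_less[of "Suc i" T] by simp_all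
    then show ?thesis using exit assms vertex_bounds(4)
      by (intro edges_separated[where \<alpha> = 0 and \<beta> = 1 and c = "y (Suc i)"]) (simp_all add: vertex_bounds vertex_upper)
  next
    case down
    then show ?thesis using assms vertex_bounds(1)[of i] vertex_bounds(1)[of "Suc i"] vertex_lower
      by (intro edges_separated[where \<alpha> = "-1" and \<beta> = 0 and c = "1/12"])
        (simp_all add: vertex_bounds vertex_upper M_eq)
  next
    case "in"
    then show ?thesis using assms vertex_bounds(1)[of i] vertex_bounds(1)[of "Suc i"] vertex_bounds(5)
      by (intro edges_separated[where \<alpha> = "-1" and \<beta> = 0 and c = "1/12"])
        (simp_all add: vertex_bounds(3) vertex_upper vertex_notch)
  next
    case out
    then have "i \<le> T" using assms by simp
    show ?thesis
    proof (cases "i = T")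
      case True
      then show ?thesis using out assms vertex_bounds(4,6,7,9) vertex_lower
        by (intro edges_separated[where \<alpha> = 0 and \<beta> = "-1" and c = "-1"])
          (simp_all add: vertex_bounds(2) vertex_upper vertex_notch M_eq)
    next
      case False
      then show ?thesis using out \<open>i \<le> T\<close> vertex_bounds(1)[of i] vertex_bounds(1)[of "Suc i"] vertex_bounds(5) vertex_lower
        by (intro edges_separated[where \<alpha> = "-1" and \<beta> = 0 and c = "1/12"])
          (simp_all add: vertex_bounds(3,8) vertex_notch M_eq)
    qed
  next
    case entry
    then have "i \<noteq> 0" using assms(4) by blast
    then have i: "1 \<le> i" "i < M" "Suc i \<noteq> M" using assms entry by auto
    have y1: "0 < y 1" "y 1 \<le> 3/2" using y_less[of 0 1] y_le[of 1 T] T_ge by auto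
    have e: "vertex K M = lower T" "vertex K (Suc M) = pleat T 0" by (simp_all add: vertex_lower vertex_wrap)
    show ?thesis
    proof (cases "i \<le> T")
      case True
      have "y 1 \<le> y i" using i by (intro y_le) simp
      moreover have "y 1 \<le> Im (vertex K (Suc i))"
      proof (cases "i = T")
        case True
        then show ?thesis using y1 vertex_bounds(4) by (simp add: vertex_upper)
      next
        case False
        then show ?thesis using \<open>i \<le> T\<close> y_le[of 1 "Suc i"] by (simp add: vertex_bounds(2))
      qed
      ultimately show ?thesis using True y1 entry e vertex_bounds(9)
        by (intro edges_separated[where \<alpha> = 0 and \<beta> = "-1" and c = "- y 1"])
          (simp_all add: vertex_bounds(2) pleat_def)
    next
      \<comment> \<open>Only the upper edge of the detour remains, which stays above level
        \<open>1/2\<close>.\<close>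
      case False
      then have "b" "i = Suc T" using i by (auto simp: last_eq last_face_def split: if_splits)
      then show ?thesis using entry e vertex_bounds(4,6,9)
        by (intro edges_separated[where \<alpha> = 0 and \<beta> = "-1" and c = "- 1/2"])
          (simp_all add: vertex_upper vertex_notch pleat_def)
    qed
  qed
qed

end

sublocale winding \<subseteq> embedded_ribbon K "height b T s"
proof
  show "above K p i j \<longleftrightarrow> h j < h i" for p i j by (simp add: K_eq wound_def)
  show "inj_on h {..<num_verts K}"
    by (auto simp: inj_on_def height_def split: if_splits)
  fix i j
  assume ij: "i < num_verts K" "j < num_verts K" "i \<noteq> j"
    "j \<noteq> Suc i mod num_verts K" "i \<noteq> Suc j mod num_verts K"
  have wlog: "edge K i \<inter> edge K j = {}"
    if "i < j" "i < num_verts K" "j < num_verts K" "j \<noteq> Suc i mod num_verts K" "i \<noteq> Suc j mod num_verts K" for i j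
    using that num_verts_K by (intro edges_apart) auto
  show "edge K i \<inter> edge K j = {}"
    using wlog[of i j] wlog[of j i] ij by (cases "i < j") auto
qed

context winding
begin

text \<open>Consecutive faces have neighbouring heights within the accordion, from face
  \<open>T\<close> to face \<open>M - 1\<close>, and at the wrap-around. Layers lie between only at
  the spiral folds, where they are earlier faces or the entering strand, and at the final return to
  that strand.\<close>

lemma between_cases:
  assumes "k < num_verts K" "q < num_verts K"
    "h k < h q \<and> h q < h (Suc k mod num_verts K) \<or> h (Suc k mod num_verts K) < h q \<and> h q < h k"
  shows "Suc k = M \<and> s \<le> q \<and> q < k \<or> s \<le> Suc k \<and> Suc k \<le> T \<and> (q < k \<or> q = M)"
proof (cases "k = M")
  case True
  then have "Suc k mod num_verts K = 0" using num_verts_K by simp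
  then show ?thesis using assms(3) True s_ge M_gt
    by (auto simp: height_def last_eq[symmetric] split: if_splits)
next
  case False
  then have "Suc k mod num_verts K = Suc k" using assms(1) num_verts_K by simp
  then show ?thesis using assms False s_ge s_le M_gt num_verts_K even_T
    by (auto simp: height_def last_eq[symmetric] split: if_splits) presburger+
qed

text \<open>The entering strand lies below level \<open>5/8\<close> and the crease above it. Earlier
  faces are spanned by creases at distance at most \<open>r k\<close> from the axis, while this
  crease is at distance \<open>r (Suc k)\<close>.\<close>

lemma spiral_fold_clear:
  assumes "s \<le> Suc k" "Suc k \<le> T" "q < k \<or> q = M"
  shows "fold_line K (Suc k) \<inter> interior (face K q) = {}"
proof (cases "q = M")
  case True
  show ?thesis
  proof (rule interior_face_separated[where \<alpha> = 0 and \<beta> = 1 and c = "5/8"])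
    fix p assume "p \<in> fold_line K q \<or> p \<in> fold_line K (Suc q)"
    then consider "p \<in> fold_line K M" | "p \<in> fold_line K 0" using True fold_wrap by auto
    then show "0 * Re p + 1 * Im p \<le> 5/8"
    proof cases
      case 1
      then show ?thesis
        using vertex_bounds(9) by (elim fold_lower) (auto simp: abs_le_iff split: if_splits)
    next
      case 2
      then show ?thesis using fold_pleat(2)[of p 0] by (simp add: abs_le_iff)
    qed
  next
    fix p assume "p \<in> fold_line K (Suc k)"
    moreover have "5/4 \<le> y (Suc k)" using y_s y_le[OF assms(1)] by linarith
    ultimately show "5/8 \<le> 0 * Re p + 1 * Im p"
      using fold_pleat(2)[of p "Suc k"] assms(2) by (simp only: abs_le_iff, linarith)
  qed simp
next
  case False
  then have q: "q < k" using assms by simp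
  \<comment> \<open>The factor \<open>(-1) ^ Suc k\<close> reflects the plane so that the crease
    always lies on the right.\<close>
  have abs: "(-1) ^ Suc k * ((-1) ^ j * x) \<le> x" if "0 < x" for j and x :: real
    using that by (cases "even k"; cases "even j") auto
  show ?thesis
  proof (rule interior_face_separated[where \<alpha> = "(-1) ^ Suc k" and \<beta> = 0 and c = "r k"])
    fix p assume "p \<in> fold_line K q \<or> p \<in> fold_line K (Suc q)"
    then obtain j where j: "p \<in> fold_line K j" "j \<le> k" using q by (metis Suc_leI less_imp_le)
    then have "(-1) ^ Suc k * Re p \<le> r j"
      using fold_pleat(1)[OF j(1)] abs[OF r_pos] assms(2) by simp
    then show "(-1) ^ Suc k * Re p + 0 * Im p \<le> r k" using r_le[OF j(2)] by simp
  next
    fix p assume "p \<in> fold_line K (Suc k)"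
    then have "Re p = (-1) ^ Suc k * r (Suc k)" using fold_pleat(1) assms(2) by blast
    then have "(-1) ^ Suc k * Re p = r (Suc k)" by (cases "even k") auto
    then show "r k \<le> (-1) ^ Suc k * Re p + 0 * Im p" using r_less[of k "Suc k"] by simp
  qed simp
qed

text \<open>The spiral faces and the exit face stay above level \<open>5/8\<close>, the crease below
  it. Only the first face of the detour descends further, and an oblique line separates it from the
  crease.\<close>

lemma lower_fold_clear:
  assumes "Suc k = M" "s \<le> q" "q < k"
  shows "fold_line K (Suc k) \<inter> interior (face K q) = {}"
proof -
  have low: "Im p \<le> 5/8 \<and> 12 * Re p + 5 * Im p \<le> - 83/16" if p: "p \<in> fold_line K (Suc k)" for p
  proof -
    obtain x where "\<bar>x\<bar> \<le> 1/2" "Re p = Re (lower T) - x * (if b then 9/11 else 1)"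
      "Im p = Im (lower T) + x * (if b then 7/11 else 1/2)"
      using fold_lower p assms(1) by metis
    moreover from this have "- (1/2) \<le> x" "x \<le> 1/2" by linarith+
    ultimately show ?thesis using vertex_bounds(8,9) by (cases b) simp_all
  qed
  consider "q < T" | "q = T" | "b" "q = Suc T"
    using assms M_eq by (cases b) force+
  then show ?thesis
  proof cases
    case 1
    have "5/8 \<le> Im p" if "p \<in> fold_line K j" "s \<le> j" "j \<le> T" for p j
      using fold_pleat(2)[OF that(1,3)] y_s y_le[OF that(2)] by (simp only: abs_le_iff) linarith
    then show ?thesis using 1 assms(2) low
      by (intro interior_face_separated[where \<alpha> = 0 and \<beta> = "-1" and c = "-5/8"]) fastforce+
  next
    case 2
    have "5/8 \<le> Im p" if "p \<in> fold_line K T" for p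
      using fold_pleat(2)[OF that] y_T by linarith
    moreover have "5/8 \<le> Im p" if p: "p \<in> fold_line K (Suc T)" for p
    proof -
      obtain x where "\<bar>x\<bar> \<le> 1/2" "Im p = Im (upper T) + x * (if b then 7/11 else 1/2)"
        using fold_upper[OF p] by metis
      moreover from this have "- (1/2) \<le> x" by linarith
      ultimately show ?thesis using vertex_bounds(4) by (cases b) simp_all
    qed
    ultimately show ?thesis using 2 low
      by (intro interior_face_separated[where \<alpha> = 0 and \<beta> = "-1" and c = "-5/8"]) fastforce+
  next
    case 3
    have "- 83/16 \<le> 12 * Re p + 5 * Im p" if p: "p \<in> fold_line K (Suc T)" for p
    proof -
      obtain x where "\<bar>x\<bar> \<le> 1/2" "Re p = Re (upper T) + x * (if b then 9/11 else 1)"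
        "Im p = Im (upper T) + x * (if b then 7/11 else 1/2)"
        using fold_upper[OF p] .
      moreover from this have "- (1/2) \<le> x" by linarith
      ultimately show ?thesis using 3(1) r_pos[of T] by (simp add: upper_def)
    qed
    moreover have "- 83/16 \<le> 12 * Re p + 5 * Im p" if p: "p \<in> fold_line K (Suc (Suc T))" for p
    proof -
      obtain x where "\<bar>x\<bar> \<le> 1/2" "Re p = Re (notch T)" "Im p = Im (notch T) - 13/5 * x"
        using fold_notch[OF p 3(1)] .
      moreover from this have "x \<le> 1/2" by linarith
      ultimately show ?thesis using r_pos[of T] by (simp add: notch_def)
    qed
    ultimately show ?thesis using 3 low
      by (intro interior_face_separated[where \<alpha> = "-12" and \<beta> = "-5" and c = "83/16"]) fastforce+
  qed
qed

section \<open>Creases share no segment\<close>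

definition vertical :: "nat \<Rightarrow> bool" where
  "vertical k \<longleftrightarrow> k \<le> T \<or> b \<and> k = Suc (Suc T)"

lemma vertical_fold:
  assumes "vertical k" "p \<in> fold_line K k"
  shows "Re p = (if k \<le> T then (-1) ^ k * r k else Re (notch T))"
  using assms fold_pleat(1)[OF assms(2)] fold_notch[of p] by (auto simp: vertical_def)

text \<open>Distinct radii put the pleat creases on distinct vertical lines within
  \<open>1/12\<close> of the axis, and the notch crease lies beyond \<open>1/6\<close>.\<close>

lemma vertical_folds_apart:
  assumes "vertical k" "vertical l" "p \<in> fold_line K k" "p \<in> fold_line K l"
  shows "k = l"
proof -
  have pleat: "\<bar>Re p\<bar> = r j" if "p \<in> fold_line K j" "j \<le> T" for j
    using fold_pleat(1)[OF that] r_pos[of j] by (simp add: abs_mult)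
  have le: "r j \<le> 1/12" if "j \<le> T" for j using r_le[OF that] r_T by linarith
  have neq: "r i \<noteq> r j" if "i \<noteq> j" for i j using r_less[of i j] r_less[of j i] that by linarith
  have notch: "1/6 < \<bar>Re p\<bar>" if "vertical j" "p \<in> fold_line K j" "\<not> j \<le> T" for j
    using vertical_fold[OF that(1,2)] that(3) vertex_bounds(5) by simp
  show ?thesis
  proof (cases "k \<le> T \<or> l \<le> T")
    case True
    then have "k \<le> T \<and> l \<le> T"
      using pleat[of k] pleat[of l] le[of k] le[of l] notch[of k] notch[of l] assms by force
    then show ?thesis using pleat[of k] pleat[of l] neq[of k l] assms(3,4) by auto
  next
    case False
    then show ?thesis using assms(1,2) unfolding vertical_def by simp
  qed
qed

text \<open>The two oblique creases have slopes of opposite sign, so they share at most one point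
  with each other or with a vertical crease.\<close>

lemma tilted_fold:
  assumes "k < num_verts K" "\<not> vertical k" "p \<in> fold_line K k" "q \<in> fold_line K k"
  shows "Re p - Re q = (if k = M then -1 else 1) * (if b then 9/7 else 2) * (Im p - Im q)"
    and "k = M \<or> k = Suc T"
proof -
  show k: "k = M \<or> k = Suc T"
    using assms(1) assms(2)[unfolded vertical_def] by (cases rule: index_cases) auto
  show "Re p - Re q = (if k = M then -1 else 1) * (if b then 9/7 else 2) * (Im p - Im q)"
  proof (cases "k = M")
    case True
    obtain x where x: "Re p = Re (lower T) - x * (if b then 9/11 else 1)"
      "Im p = Im (lower T) + x * (if b then 7/11 else 1/2)"
      using assms(3) True by (auto elim: fold_lower)
    obtain z where z: "Re q = Re (lower T) - z * (if b then 9/11 else 1)"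
      "Im q = Im (lower T) + z * (if b then 7/11 else 1/2)"
      using assms(4) True by (auto elim: fold_lower)
    show ?thesis unfolding x z using True by (simp add: algebra_simps)
  next
    case False
    then have S: "k = Suc T" using k by simp
    obtain x where x: "Re p = Re (upper T) + x * (if b then 9/11 else 1)"
      "Im p = Im (upper T) + x * (if b then 7/11 else 1/2)"
      using assms(3) S by (auto elim: fold_upper)
    obtain z where z: "Re q = Re (upper T) + z * (if b then 9/11 else 1)"
      "Im q = Im (upper T) + z * (if b then 7/11 else 1/2)"
      using assms(4) S by (auto elim: fold_upper)
    show ?thesis unfolding x z using False by (simp add: algebra_simps)
  qed
qed

lemma folds_do_not_overlap:
  assumes "k < num_verts K" "l < num_verts K" "k \<noteq> l" "{p, q} \<subseteq> fold_line K k \<inter> fold_line K l"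
  shows "p = q"
proof -
  have mem: "p \<in> fold_line K k" "q \<in> fold_line K k" "p \<in> fold_line K l" "q \<in> fold_line K l"
    using assms(4) by auto
  consider "vertical k" "vertical l" | "vertical k" "\<not> vertical l" | "\<not> vertical k" "vertical l"
    | "\<not> vertical k" "\<not> vertical l" by blast
  then have "Re p = Re q \<and> Im p = Im q"
  proof cases
    case 1
    then show ?thesis using vertical_folds_apart mem assms(3) by blast
  next
    case 2
    then have "Re p = Re q" using vertical_fold mem by simp
    then show ?thesis using tilted_fold(1)[OF assms(2) 2(2) mem(3,4)] by (auto split: if_splits)
  next
    case 3
    then have "Re p = Re q" using vertical_fold mem by simp
    then show ?thesis using tilted_fold(1)[OF assms(1) 3(1) mem(1,2)] by (auto split: if_splits)
  next
    case 4
    then show ?thesis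
      using tilted_fold[OF assms(1) 4(1) mem(1,2)] tilted_fold[OF assms(2) 4(2) mem(3,4)] assms(3)
      by (auto split: if_splits)
  qed
  then show ?thesis by (simp add: complex_eq_iff)
qed

section \<open>The knot, its length and its fold signs\<close>

lemma folded_ribbon_knot_winding: "folded_ribbon_knot K"
proof (rule folded_ribbon_knotI)
  fix k q
  assume "k < num_verts K" "q < num_verts K"
    "h k < h q \<and> h q < h (Suc k mod num_verts K) \<or> h (Suc k mod num_verts K) < h q \<and> h q < h k"
  then show "fold_line K (Suc k) \<inter> interior (face K q) = {}"
    using between_cases lower_fold_clear spiral_fold_clear by blast
qed (rule folds_do_not_overlap)

text \<open>In direction (4/5, 3/5) the zigzag is 5/3 times as long as it is high, which is
  \<open>5/2\<close> for every \<open>T\<close>. The detour lengthens the descent by the factor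
  \<open>13/12\<close>; the total stays below 7.6.\<close>

lemma ribbonlength_less: "ribbonlength K < 8"
proof -
  have start: "k \<le> T \<Longrightarrow> start k = 5/3 * y k" for k
    by (induction k) (simp_all add: dir_pleat y_Suc)
  have T: "start T = 5/2" using start[of T] by simp
  have exit: "len K T = 5/4 * r T + 15/16" by (simp add: dir_pleat)
  have entry: "len K M = 5/4 * r 0 + 15/16" by (simp add: dir_entry)
  have "start M \<le> 5/2 + len K T + 13/12 * descent T"
    using T descent_bounds by (cases b) (simp_all add: M_eq dir_down dir_in dir_out)
  moreover have "ribbonlength K = start M + len K M" unfolding ribbonlength_eq num_verts_K by simp
  ultimately show ?thesis using exit entry r_T r_0 descent_bounds by linarith
qed

text \<open>In the accordion every face goes below the previous one, so the signs alternate with the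
  turns. In the spiral the change of height alternates as well, and the product is constant.\<close>

lemma fold_sign_values:
  "k < T \<Longrightarrow> fold_sign k = (if Suc k < s then (-1) ^ Suc k else -1)"
  "fold_sign T = -1"
  "\<not> b \<Longrightarrow> fold_sign (Suc T) = 1"
  "b \<Longrightarrow> fold_sign (Suc T) = 1"
  "b \<Longrightarrow> fold_sign (Suc (Suc T)) = 1"
  "fold_sign M = 1"
proof -
  have mod: "Suc k mod num_verts K = Suc k" if "k < M" for k using that num_verts_K by simp
  have modM: "Suc M mod num_verts K = 0" using num_verts_K by simp
  note def = fold_sign_def height_def last_eq[symmetric] turn_def
  show "fold_sign T = -1" "\<not> b \<Longrightarrow> fold_sign (Suc T) = 1" "b \<Longrightarrow> fold_sign (Suc T) = 1"
    "b \<Longrightarrow> fold_sign (Suc (Suc T)) = 1"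
    unfolding def using s_le M_gt even_T by (simp_all add: mod M_eq turning_values)
  show "fold_sign M = 1" unfolding def using s_ge M_gt by (simp add: modM turning_values)
  assume k: "k < T"
  then have "k < M" "Suc k < M" using M_gt by auto
  \<comment> \<open>For even \<open>k\<close>, face \<open>Suc k\<close> is thus an odd face before
    \<open>T\<close>, which in the spiral goes to the bottom.\<close>
  moreover have "Suc k < T" if "even k" using that k even_T by (metis Suc_lessI even_Suc)
  ultimately show "fold_sign k = (if Suc k < s then (-1) ^ Suc k else -1)"
    using k even_s even_T
    by (cases "even k"; cases "Suc k < s"; cases "k < s") (auto simp: def mod turning_values sgn_if)
qed

lemma sum_alternating: "(\<Sum>k<2 * n. (-1) ^ k) = (0 :: real)"
  by (induction n) simp_all

text \<open>The accordion and the exit fold contribute -1 each, the final folds 2, or 3 with the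
  notch. Hence the \<open>Suc T - s\<close> spiral folds remain, corrected by one for the
  annulus.\<close>

lemma sum_fold_signs: "(\<Sum>k<num_verts K. fold_sign k) = (if b then 1 else 0) - real (Suc T - s)"
proof -
  obtain u where u: "s = 2 * u" using even_s by (auto elim: evenE)
  define v where "v = s - 1"
  have v: "s = Suc v" "v \<le> T" using s_ge s_le by (auto simp: v_def)
  have "(\<Sum>k<T. fold_sign k) = (\<Sum>k<T. if Suc k < s then (-1) ^ Suc k else -1)"
    by (intro sum.cong) (simp_all add: fold_sign_values(1))
  also have "\<dots> = (\<Sum>k=0..<v. if Suc k < s then (-1) ^ Suc k else -1) +
      (\<Sum>k=v..<T. if Suc k < s then (-1) ^ Suc k else -1)"
    unfolding lessThan_atLeast0 using v by (intro sum.atLeastLessThan_concat[symmetric]) auto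
  also have "(\<Sum>k=0..<v. if Suc k < s then (-1) ^ Suc k else -1) = (\<Sum>k<v. (-1) ^ Suc k :: real)"
    unfolding lessThan_atLeast0 using v(1) by (intro sum.cong) auto
  also have "(\<Sum>k=v..<T. if Suc k < s then (-1) ^ Suc k else -1) = - real (T - v)"
    using v(1) by simp
  \<comment> \<open>The accordion has the odd number \<open>s - 1\<close> of folds, so a single -1
    survives.\<close>
  also have "(\<Sum>k<v. (-1) ^ Suc k) = (-1 :: real)"
  proof -
    have "Suc v = 2 * u" using u v by simp
    then have "odd v" by presburger
    have "(\<Sum>k<v. (-1 :: real) ^ k) + (-1) ^ v = 0"
      using sum_alternating[of u] by (simp flip: \<open>Suc v = 2 * u\<close>)
    then show ?thesis using \<open>odd v\<close> by (simp add: sum_negf)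
  qed
  also have "-1 + - real (T - v) = - 1 - real (Suc T - s)" using v by simp
  finally have pleats: "(\<Sum>k<T. fold_sign k) = - 1 - real (Suc T - s)" .
  show ?thesis
  proof (cases b)
    case True
    have "(\<Sum>k<num_verts K. fold_sign k) =
        (\<Sum>k<T. fold_sign k) + fold_sign T + fold_sign (Suc T) + fold_sign (Suc (Suc T)) + fold_sign M"
      unfolding num_verts_K M_eq(1)[OF True] by simp
    then have "(\<Sum>k<num_verts K. fold_sign k) = 1 - real (Suc T - s)"
      unfolding pleats fold_sign_values(2,6) fold_sign_values(4,5)[OF True] by simp
    then show ?thesis unfolding if_P[OF True] .
  next
    case False
    have "(\<Sum>k<num_verts K. fold_sign k) =
        (\<Sum>k<T. fold_sign k) + fold_sign T + fold_sign (Suc T) + fold_sign M"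
      unfolding num_verts_K M_eq(2)[OF False] by simp
    then have "(\<Sum>k<num_verts K. fold_sign k) = 0 - real (Suc T - s)"
      unfolding pleats fold_sign_values(2,6) fold_sign_values(3)[OF False] by simp
    then show ?thesis unfolding if_not_P[OF False] .
  qed
qed

end

theorem lemma1:
  shows "\<exists>K :: nat \<Rightarrow> folded_ribbon.
    (\<forall>n. folded_ribbon_knot (K n)) \<and>
    (\<forall>n. odd n \<longrightarrow> topological_mobius_band (K n) \<and>
       (has_ribbon_linking_number (K n) (real n) \<or> has_ribbon_linking_number (K n) (- real n))) \<and>
    (\<forall>n. even n \<longrightarrow> topological_annulus (K n) \<and>
       (has_ribbon_linking_number (K n) (real n / 2) \<or> has_ribbon_linking_number (K n) (- real n / 2))) \<and>
    (\<exists>c :: real. \<forall>n. ribbonlength (K n) < c) \<and>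
    (\<forall>n. ribbonlength (K n) < 8)"
proof -
  \<comment> \<open>There are \<open>2 * (n div 2) + 1\<close> spiral folds: \<open>n\<close> for
    odd \<open>n\<close>, and \<open>n + 1\<close> for even \<open>n\<close>, where the notch fold
    cancels one. The factor \<open>24 * (n + 1)\<close> keeps the ratio of \<open>T n\<close> to
    \<open>s n\<close> at most 25/24.\<close>
  define s T :: "nat \<Rightarrow> nat" where "s n = 24 * (n + 1)" and "T n = s n + 2 * (n div 2)" for n
  define K where "K n = wound (even n) (T n) (s n)" for n
  have winding: "winding (even n) (T n) (s n) (K n) (last_face (even n) (T n))" for n
  proof
    have nat: "24 * T n \<le> 25 * s n" by (simp add: T_def s_def)
    then have T: "real (T n) \<le> 25/24 * real (s n)" by (simp flip: of_nat_mult add: field_simps)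
    then have "real (T n) * (real (T n) + 1) \<le> (25/24 * real (s n)) * (25/24 * (real (s n) + 1))"
      by (intro mult_mono) auto
    \<comment> \<open>The square of 25/24 is less than the 6/5 demanded by
      \<open>climb\<close>.\<close>
    also have "\<dots> = 625/576 * (real (s n) * (real (s n) + 1))" by simp
    finally have "real (T n) * (real (T n) + 1) \<le> 625/576 * (real (s n) * (real (s n) + 1))" .
    moreover have "0 \<le> real (s n) * (real (s n) + 1)" by simp
    ultimately show "5 * (real (T n) * (real (T n) + 1)) \<le> 6 * (real (s n) * (real (s n) + 1))"
      by linarith
  qed (simp_all add: K_def T_def s_def)
  have parity: "even (num_verts (K n)) \<longleftrightarrow> even n" for n
    unfolding winding.num_verts_K[OF winding] using winding.even_T[OF winding[of n]]
    by (simp add: last_face_def)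
  have linking: "has_ribbon_linking_number (K n) ((if even n then 1/2 else 1) * - real n)" for n
  proof -
    interpret winding "even n" "T n" "s n" "K n" "last_face (even n) (T n)" by (rule winding)
    have "(if even n then 1 else 0) - real (Suc (T n) - s n) = - real n"
      by (cases "even n") (auto simp: T_def elim!: evenE oddE)
    then show ?thesis using has_linking_number by (simp only: sum_fold_signs parity)
  qed
  have "folded_ribbon_knot (K n)" "ribbonlength (K n) < 8" for n
    using winding.folded_ribbon_knot_winding[OF winding] winding.ribbonlength_less[OF winding] by auto
  moreover have "topological_mobius_band (K n)" if "odd n" for n
  proof -
    interpret winding "even n" "T n" "s n" "K n" "last_face (even n) (T n)" by (rule winding)
    show ?thesis using topological_mobius_band_if_odd parity that by blast
  qed
  moreover have "topological_annulus (K n)" if "even n" for n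
  proof -
    interpret winding "even n" "T n" "s n" "K n" "last_face (even n) (T n)" by (rule winding)
    show ?thesis using topological_annulus_if_even parity that by blast
  qed
  moreover have "has_ribbon_linking_number (K n) (- real n)" if "odd n" for n
    using linking[of n] that by simp
  moreover have "has_ribbon_linking_number (K n) (- real n / 2)" if "even n" for n
    using linking[of n] that by simp
  ultimately show ?thesis by blast
qed

end
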